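(* Let $X$ be a connected non-complete graph on $n$ vertices. Then $\operatorname{tr}(X)\le \operatorname{tr}(S_n)$, with equality if and only if $X=S_n$ (up to isomorphism).
   Context: Graphs are finite and simple. For a graph $X$, let $L=D-A$ be its Laplacian matrix, with spectral decomposition $L=\sum_\lambda \lambda E_\lambda$, where $\lambda$ runs over the distinct eigenvalues of $L$ and $E_\lambda$ is the orthogonal projection onto the $\lambda$-eigenspace. The average mixing matrix is $\widehat{M}=\sum_\lambda E_\lambda\circ E_\lambda$ ($\circ$ is the entrywise product), and the laziness of $X$ is $\operatorname{tr}(X):=\operatorname{tr}(\widehat M)=\sum_\lambda\sum_{u\in V(X)} ((E_\lambda)_{uu})^2$. $S_n=K_{1,n-1}$ denotes the star on $n$ vertices. *)

theory Defs
  imports "HOL-Analysis.Analysis" "Graph_Theory.Graph_Theory"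
begin

text \<open>
  A finite simple graph is a \<open>graph\<close> in the sense of \<open>Graph_Theory\<close>, i.e. a finite symmetric
  digraph without loops and parallel arcs. Each edge gives two opposite arcs, so the degree of a
  vertex is its \<open>out_degree\<close>. The matrices are indexed by the whole vertex type, so they are the
  usual ones only for graphs \<open>G\<close> with \<open>verts G = UNIV\<close>.
\<close>

definition adjacency_matrix :: "('v::finite, 'e) pre_digraph \<Rightarrow> real^'v^'v" where
  "adjacency_matrix G = (\<chi> u v. if u \<rightarrow>\<^bsub>G\<^esub> v then 1 else 0)"

definition degree_matrix :: "('v::finite, 'e) pre_digraph \<Rightarrow> real^'v^'v" where
  "degree_matrix G = (\<chi> u v. if u = v then real (out_degree G u) else 0)"

definition laplacian :: "('v::finite, 'e) pre_digraph \<Rightarrow> real^'v^'v" where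
  "laplacian G = degree_matrix G - adjacency_matrix G"

definition eigenspace :: "real^'n^'n \<Rightarrow> real \<Rightarrow> (real^'n) set" where
  "eigenspace A \<mu> = {x. A *v x = \<mu> *\<^sub>R x}"

definition eigenvalues :: "real^'n^'n \<Rightarrow> real set" where
  "eigenvalues A = {\<mu>. \<exists>x. x \<noteq> 0 \<and> A *v x = \<mu> *\<^sub>R x}"

definition is_orthogonal_projection :: "real^'n^'n \<Rightarrow> (real^'n) set \<Rightarrow> bool" where
  "is_orthogonal_projection P S \<longleftrightarrow> (\<forall>x. P *v x \<in> S \<and> x - P *v x \<in> S\<^sup>\<bottom>)"

definition orthogonal_projection :: "(real^'n) set \<Rightarrow> real^'n^'n" where
  "orthogonal_projection S = (THE P. is_orthogonal_projection P S)"

lemma orthogonal_projection_exists_unique: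
  fixes S :: "(real^'n) set"
  assumes S: "subspace S"
  shows "\<exists>!P. is_orthogonal_projection P S"
proof -
  have dec: "\<exists>y. y \<in> S \<and> x - y \<in> S\<^sup>\<bottom>" for x
  proof -
    obtain y z where "y \<in> S" "\<And>w. w \<in> S \<Longrightarrow> orthogonal z w" "x = y + z"
      using orthogonal_subspace_decomp_exists[of S x] S by (metis span_eq_iff)
    then show ?thesis
      by (intro exI[of _ y]) (auto simp: orthogonal_comp_def orthogonal_commute)
  qed
  have uniq: "y = z" if "y \<in> S" "x - y \<in> S\<^sup>\<bottom>" "z \<in> S" "x - z \<in> S\<^sup>\<bottom>" for x y z
  proof -
    have "y - z \<in> S" using S that by (simp add: subspace_diff)
    moreover have "(x - z) - (x - y) \<in> S\<^sup>\<bottom>"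
      by (rule subspace_diff[OF subspace_orthogonal_comp that(4,2)])
    ultimately have "orthogonal (y - z) (y - z)" by (simp add: orthogonal_comp_def)
    then show ?thesis by (simp add: orthogonal_def)
  qed
  define p where "p x = (SOME y. y \<in> S \<and> x - y \<in> S\<^sup>\<bottom>)" for x
  have p: "p x \<in> S" "x - p x \<in> S\<^sup>\<bottom>" for x
    using someI_ex[OF dec[of x]] by (auto simp: p_def)
  have "linear p"
  proof (rule linearI)
    fix x y
    have "(x - p x) + (y - p y) \<in> S\<^sup>\<bottom>"
      by (rule subspace_add[OF subspace_orthogonal_comp p(2) p(2)])
    then show "p (x + y) = p x + p y"
      by (intro uniq[of _ "x + y"] p subspace_add[OF S]) (simp add: algebra_simps)
  next
    fix c x
    have "c *\<^sub>R (x - p x) \<in> S\<^sup>\<bottom>"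
      by (rule subspace_scale[OF subspace_orthogonal_comp p(2)])
    then show "p (c *\<^sub>R x) = c *\<^sub>R p x"
      by (intro uniq[of _ "c *\<^sub>R x"] p subspace_scale[OF S]) (simp add: algebra_simps)
  qed
  then have "is_orthogonal_projection (matrix p) S"
    by (simp add: is_orthogonal_projection_def matrix_works p)
  moreover have "P = Q"
    if "is_orthogonal_projection P S" "is_orthogonal_projection Q S" for P Q
    using that unfolding matrix_eq is_orthogonal_projection_def by (metis uniq)
  ultimately show ?thesis by blast
qed

lemma subspace_eigenspace: "subspace (eigenspace A \<mu>)"
  by (auto simp: subspace_def eigenspace_def matrix_vector_right_distrib
      matrix_vector_mult_scaleR scaleR_add_right)

lemma finite_eigenvalues:
  fixes A :: "real^'n^'n"
  assumes A: "transpose A = A"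
  shows "finite (eigenvalues A)"
proof -
  define v where "v \<mu> = (SOME x. x \<noteq> 0 \<and> A *v x = \<mu> *\<^sub>R x)" for \<mu>
  have v: "v \<mu> \<noteq> 0" "A *v v \<mu> = \<mu> *\<^sub>R v \<mu>" if "\<mu> \<in> eigenvalues A" for \<mu>
    using that someI_ex[of "\<lambda>x. x \<noteq> 0 \<and> A *v x = \<mu> *\<^sub>R x"]
    by (auto simp: v_def eigenvalues_def)
  have orth: "orthogonal (v \<mu>) (v \<nu>)"
    if "\<mu> \<in> eigenvalues A" "\<nu> \<in> eigenvalues A" "\<mu> \<noteq> \<nu>" for \<mu> \<nu>
  proof -
    have "(A *v v \<mu>) \<bullet> v \<nu> = v \<mu> \<bullet> (A *v v \<nu>)"
      using A by (metis dot_lmul_matrix transpose_matrix_vector)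
    then have "(\<mu> - \<nu>) * (v \<mu> \<bullet> v \<nu>) = 0"
      using v that by (simp add: algebra_simps)
    then show ?thesis using that by (simp add: orthogonal_def)
  qed
  have inj: "inj_on v (eigenvalues A)"
    by (rule inj_onI) (metis orth v(1) orthogonal_self)
  have "independent (v ` eigenvalues A)"
    by (rule pairwise_orthogonal_independent)
      (use orth v(1) in \<open>auto simp: pairwise_def\<close>)
  then show ?thesis
    using inj finiteI_independent finite_imageD by blast
qed

lemma transpose_laplacian:
  assumes "graph G"
  shows "transpose (laplacian G) = laplacian G"
proof -
  interpret graph G by fact
  show ?thesis
    by (auto simp: transpose_def laplacian_def degree_matrix_def adjacency_matrix_def vec_eq_iff
        dest: arcs_ends_symmetric[OF sym_arcs])
qed

text \<open>Multiplication \<open>*\<close> on \<^typ>\<open>real^'n^'n\<close> is the entrywise product.\<close>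

definition average_mixing_matrix :: "('v::finite, 'e) pre_digraph \<Rightarrow> real^'v^'v" where
  "average_mixing_matrix G =
    (\<Sum>\<mu>\<in>eigenvalues (laplacian G).
      orthogonal_projection (eigenspace (laplacian G) \<mu>) *
      orthogonal_projection (eigenspace (laplacian G) \<mu>))"

definition laziness :: "('v::finite, 'e) pre_digraph \<Rightarrow> real" where
  "laziness G = trace (average_mixing_matrix G)"

lemma laziness_eq:
  "laziness G =
    (\<Sum>\<mu>\<in>eigenvalues (laplacian G). \<Sum>u\<in>UNIV.
      (orthogonal_projection (eigenspace (laplacian G) \<mu>) $ u $ u)\<^sup>2)"
  unfolding laziness_def average_mixing_matrix_def trace_def
  by (simp add: power2_eq_square) (rule sum.swap)

end

theory Submission
  imports Defs
begin

text \<open>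
  Let \<open>P = E\<^sub>\<theta>\<close> for a nonzero Laplacian eigenvalue \<open>\<theta>\<close>. As \<open>X\<close> is connected, \<open>E\<^sub>0 = J / n\<close>, so the
  other eigenprojections add up to the projection \<open>Q = I - J / n - P\<close>, which is nonzero as \<open>X\<close> is
  not complete. Merging these eigenspaces does not decrease the sum of squares, hence
  \<open>tr(X) \<le> const - 2 \<Sum>\<^sub>u P\<^sub>u\<^sub>u Q\<^sub>u\<^sub>u\<close>, where \<open>Q\<^sub>u\<^sub>u = c - P\<^sub>u\<^sub>u\<close> with \<open>c = 1 - 1 / n\<close>.
  If \<open>P\<close> and \<open>Q\<close> have rank at least 2, concavity bounds the last sum strictly. If one of them is
  \<open>v v\<^sup>T\<close>, the sum is \<open>c - \<Sum>\<^sub>u v\<^sub>u\<^sup>4\<close>, and among the unit vectors orthogonal to \<open>1\<close> the quartic sum is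
  maximal exactly for the multiples of \<open>n e\<^sub>u - 1\<close>, provided that \<open>n \<ge> 4\<close>.
  For \<open>n = 3\<close> the star is the only connected non-complete graph.

  In the case of equality \<open>n e\<^sub>u - 1\<close> is an eigenvector, so \<open>u\<close> is adjacent to all other vertices.
  Moreover each \<open>e\<^sub>w\<close> is, modulo \<open>1\<close> and \<open>n e\<^sub>u - 1\<close>, an eigenvector, which forces \<open>w \<noteq> u\<close> to be adjacent
  to all or to none of the vertices other than \<open>u\<close>.
\<close>

section \<open>Spectral decomposition of symmetric matrices\<close>

lemma inner_symmetric_matrix:
  fixes A :: "real^'n^'n"
  assumes "transpose A = A"
  shows "(A *v x) \<bullet> y = x \<bullet> (A *v y)"
  using assms by (metis dot_lmul_matrix transpose_matrix_vector)

lemma orthogonal_eigenvectors: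
  fixes A :: "real^'n^'n"
  assumes A: "transpose A = A" and x: "x \<in> eigenspace A \<mu>" and y: "y \<in> eigenspace A \<nu>"
    and ne: "\<mu> \<noteq> \<nu>"
  shows "x \<bullet> y = 0"
proof -
  have "(\<mu> - \<nu>) * (x \<bullet> y) = 0"
    using inner_symmetric_matrix[OF A, of x y] x y by (simp add: eigenspace_def algebra_simps)
  then show ?thesis using ne by simp
qed

lemma symmetric_invariant_subspace_eigenvector:
  fixes A :: "real^'n^'n"
  assumes A: "transpose A = A" and V: "subspace V" and inv: "\<And>x. x \<in> V \<Longrightarrow> A *v x \<in> V"
    and ne: "y \<in> V" "y \<noteq> 0"
  obtains x \<mu> where "x \<in> V" "x \<noteq> 0" "A *v x = \<mu> *\<^sub>R x"
proof -
  define K where "K = V \<inter> sphere 0 1"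
  have "compact K"
    unfolding K_def by (intro closed_Int_compact closed_subspace V compact_sphere)
  moreover have "(1 / norm y) *\<^sub>R y \<in> K"
    using ne V by (simp add: K_def subspace_scale)
  moreover have "continuous_on K (\<lambda>x. x \<bullet> (A *v x))"
    by (intro continuous_intros)
  ultimately obtain x where x: "x \<in> K" and max: "\<And>z. z \<in> K \<Longrightarrow> z \<bullet> (A *v z) \<le> x \<bullet> (A *v x)"
    using continuous_attains_sup[of K "\<lambda>x. x \<bullet> (A *v x)"] by blast
  define m where "m = x \<bullet> (A *v x)"
  have xV: "x \<in> V" and xx: "x \<bullet> x = 1"
    using x by (auto simp: K_def dot_square_norm)
  have le: "z \<bullet> (A *v z) \<le> m * (z \<bullet> z)" if "z \<in> V" for z
  proof (cases "z = 0")
    case False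
    have "(1 / norm z) *\<^sub>R z \<in> K"
      using that False V by (simp add: K_def subspace_scale)
    from max[OF this] show ?thesis
      using False by (simp add: m_def[symmetric] matrix_vector_mult_scaleR dot_square_norm
          field_simps power2_eq_square)
  qed simp
  define w where "w = A *v x - m *\<^sub>R x"
  have wV: "w \<in> V" by (simp add: w_def V subspace_diff subspace_scale inv xV)
  define c where "c = m * (w \<bullet> w) - w \<bullet> (A *v w)"
  have c: "0 \<le> c" using le[OF wV] by (simp add: c_def)
  have ineq: "2 * t * (w \<bullet> w) \<le> t\<^sup>2 * c" for t
  proof -
    have wx: "w \<bullet> (A *v x) = w \<bullet> w + m * (w \<bullet> x)"
      by (simp add: w_def algebra_simps)
    have xw: "x \<bullet> (A *v w) = w \<bullet> (A *v x)"
      using inner_symmetric_matrix[OF A, of x w] by (simp add: inner_commute)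
    have "x + t *\<^sub>R w \<in> V" by (simp add: V subspace_add subspace_scale wV xV)
    from le[OF this] show ?thesis
      by (simp add: matrix_vector_right_distrib matrix_vector_mult_scaleR inner_add_left
          inner_add_right xw wx m_def[symmetric] xx c_def inner_commute[of x w])
        (simp add: algebra_simps power2_eq_square)
  qed
  have "w \<bullet> w = 0"
  proof (rule ccontr)
    assume "w \<bullet> w \<noteq> 0"
    then have pos: "w \<bullet> w > 0" by simp
    show False
    proof (cases "c = 0")
      case True
      then show False using ineq[of 1] pos by simp
    next
      case False
      have "0 < (w \<bullet> w) * (w \<bullet> w)" using pos by simp
      then show False using ineq[of "(w \<bullet> w) / c"] False c
        by (simp add: field_simps power2_eq_square)
    qed
  qed
  then have "A *v x = m *\<^sub>R x" by (simp add: w_def)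
  moreover have "x \<noteq> 0" using xx by auto
  ultimately show ?thesis using that xV by blast
qed

lemma is_orthogonal_projection_orthogonal_projection:
  "subspace S \<Longrightarrow> is_orthogonal_projection (orthogonal_projection S) S"
  unfolding orthogonal_projection_def by (rule theI') (rule orthogonal_projection_exists_unique)

lemma orthogonal_projection_eqI:
  "subspace S \<Longrightarrow> is_orthogonal_projection P S \<Longrightarrow> orthogonal_projection S = P"
  using orthogonal_projection_exists_unique is_orthogonal_projection_orthogonal_projection by blast

lemma orthogonal_projection_in:
  assumes "is_orthogonal_projection P S"
  shows "P *v x \<in> S"
  using assms by (simp add: is_orthogonal_projection_def)

lemma orthogonal_projection_diff:
  assumes "is_orthogonal_projection P S" "y \<in> S"
  shows "(x - P *v x) \<bullet> y = 0"
  using assms by (auto simp: is_orthogonal_projection_def orthogonal_comp_def orthogonal_def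
      inner_commute)

lemma inner_orthogonal_projection:
  assumes "is_orthogonal_projection P S" "y \<in> S"
  shows "(P *v x) \<bullet> y = x \<bullet> y"
  using orthogonal_projection_diff[OF assms, of x] by (simp add: inner_diff_left)

lemma is_orthogonal_projectionI:
  assumes "\<And>x. P *v x \<in> S" "\<And>x y. y \<in> S \<Longrightarrow> (x - P *v x) \<bullet> y = 0"
  shows "is_orthogonal_projection P S"
  using assms by (auto simp: is_orthogonal_projection_def orthogonal_comp_def orthogonal_def
      inner_commute)

abbreviation spectral_projection :: "real^'n^'n \<Rightarrow> real \<Rightarrow> real^'n^'n" where
  "spectral_projection A \<mu> \<equiv> orthogonal_projection (eigenspace A \<mu>)"

lemma spectral_projection: "is_orthogonal_projection (spectral_projection A \<mu>) (eigenspace A \<mu>)"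
  by (simp add: is_orthogonal_projection_orthogonal_projection subspace_eigenspace)

lemma sum_spectral_projection:
  fixes A :: "real^'n^'n"
  assumes A: "transpose A = A"
  shows "(\<Sum>\<mu>\<in>eigenvalues A. spectral_projection A \<mu> *v x) = x"
proof -
  define V where "V = {z. \<forall>\<mu>. \<forall>y\<in>eigenspace A \<mu>. z \<bullet> y = 0}"
  have V: "subspace V" by (auto simp: V_def subspace_def inner_add_left)
  have inv: "A *v z \<in> V" if "z \<in> V" for z
    using that by (auto simp: V_def inner_symmetric_matrix[OF A] eigenspace_def)
  define z where "z = x - (\<Sum>\<mu>\<in>eigenvalues A. spectral_projection A \<mu> *v x)"
  have "z \<bullet> y = 0" if y: "y \<in> eigenspace A \<nu>" for \<nu> y
  proof (cases "y = 0")
    case False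
    then have \<nu>: "\<nu> \<in> eigenvalues A" using y by (auto simp: eigenspace_def eigenvalues_def)
    have "(\<Sum>\<mu>\<in>eigenvalues A. (spectral_projection A \<mu> *v x) \<bullet> y)
        = (\<Sum>\<mu>\<in>eigenvalues A. if \<mu> = \<nu> then x \<bullet> y else 0)"
      using y by (intro sum.cong refl) (auto intro: orthogonal_eigenvectors[OF A]
        orthogonal_projection_in[OF spectral_projection] inner_orthogonal_projection[OF spectral_projection])
    also have "\<dots> = x \<bullet> y" using \<nu> by (simp add: finite_eigenvalues[OF A])
    finally show ?thesis by (simp add: z_def inner_diff_left inner_sum_left)
  qed simp
  then have zV: "z \<in> V" by (simp add: V_def)
  have "z = 0"
  proof (rule ccontr)
    assume "z \<noteq> 0"
    then obtain y \<mu> where "y \<in> V" "y \<noteq> 0" "A *v y = \<mu> *\<^sub>R y"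
      using symmetric_invariant_subspace_eigenvector[OF A V inv zV] by metis
    then show False by (force simp: V_def eigenspace_def)
  qed
  then show ?thesis by (simp add: z_def)
qed

lemma spectral_decomposition_unique:
  fixes A :: "real^'n^'n"
  assumes A: "transpose A = A" and fin: "finite \<Lambda>"
    and eig: "\<And>\<mu> x. \<mu> \<in> \<Lambda> \<Longrightarrow> A *v (M \<mu> *v x) = \<mu> *\<^sub>R (M \<mu> *v x)"
    and nz: "\<And>\<mu>. \<mu> \<in> \<Lambda> \<Longrightarrow> M \<mu> \<noteq> 0" and id: "\<And>x. (\<Sum>\<mu>\<in>\<Lambda>. M \<mu> *v x) = x"
  shows "eigenvalues A = \<Lambda>" and "\<And>\<mu>. \<mu> \<in> \<Lambda> \<Longrightarrow> spectral_projection A \<mu> = M \<mu>"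
proof -
  have orth: "(M \<mu> *v x) \<bullet> y = 0" if "y \<in> eigenspace A \<nu>" "\<mu> \<in> \<Lambda>" "\<mu> \<noteq> \<nu>" for \<mu> \<nu> x y
    by (rule orthogonal_eigenvectors[OF A _ that(1) that(3)])
       (simp add: eigenspace_def eig that)
  show "eigenvalues A = \<Lambda>"
  proof (intro equalityI subsetI)
    fix \<nu> assume "\<nu> \<in> eigenvalues A"
    then obtain y where y: "y \<noteq> 0" "y \<in> eigenspace A \<nu>"
      by (auto simp: eigenvalues_def eigenspace_def)
    show "\<nu> \<in> \<Lambda>"
    proof (rule ccontr)
      assume "\<nu> \<notin> \<Lambda>"
      then have "(\<Sum>\<mu>\<in>\<Lambda>. (M \<mu> *v y) \<bullet> y) = 0"
        by (intro sum.neutral ballI orth[OF y(2)]) auto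
      then have "y \<bullet> y = 0" using id[of y] by (metis inner_sum_left)
      then show False using y by simp
    qed
  next
    fix \<mu> assume \<mu>: "\<mu> \<in> \<Lambda>"
    obtain x where "M \<mu> *v x \<noteq> 0" using nz[OF \<mu>] by (auto simp: matrix_eq)
    then show "\<mu> \<in> eigenvalues A" using eig[OF \<mu>] by (auto simp: eigenvalues_def)
  qed
  fix \<mu> assume \<mu>: "\<mu> \<in> \<Lambda>"
  show "spectral_projection A \<mu> = M \<mu>"
  proof (intro orthogonal_projection_eqI subspace_eigenspace is_orthogonal_projectionI)
    show "M \<mu> *v x \<in> eigenspace A \<mu>" for x using eig[OF \<mu>] by (simp add: eigenspace_def)
    fix x y assume y: "y \<in> eigenspace A \<mu>"
    have "x - M \<mu> *v x = (\<Sum>\<nu>\<in>\<Lambda> - {\<mu>}. M \<nu> *v x)"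
      using id[of x] sum.remove[OF fin \<mu>, of "\<lambda>\<nu>. M \<nu> *v x"] by (simp add: algebra_simps)
    then show "(x - M \<mu> *v x) \<bullet> y = 0"
      by (simp add: inner_sum_left orth[OF y])
  qed
qed

lemma orthogonal_projection_entries:
  fixes P :: "real^'n^'n"
  assumes S: "subspace S" and P: "is_orthogonal_projection P S"
  obtains B where "finite B" "card B = dim S" "B \<subseteq> S" "\<And>b. b \<in> B \<Longrightarrow> b \<bullet> b = 1"
    "\<And>u v. P $ u $ v = (\<Sum>b\<in>B. b $ u * b $ v)"
proof -
  obtain B where B: "B \<subseteq> S" "pairwise orthogonal B" "\<And>x. x \<in> B \<Longrightarrow> norm x = 1"
    "independent B" "card B = dim S" "span B = S"
    using orthonormal_basis_subspace[OF S] by metis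
  have fin: "finite B" using B(4) by (rule finiteI_independent)
  have bb: "b \<bullet> b = 1" if "b \<in> B" for b using B(3)[OF that] by (simp add: dot_square_norm)
  have "orthogonal_projection S = (\<chi> u v. \<Sum>b\<in>B. b $ u * b $ v)"
  proof (intro orthogonal_projection_eqI S is_orthogonal_projectionI)
    have eq: "(\<chi> u v. \<Sum>b\<in>B. b $ u * b $ v) *v x = (\<Sum>b\<in>B. (b \<bullet> x) *\<^sub>R b)" for x
      by (simp add: vec_eq_iff matrix_vector_mult_def inner_vec_def sum_distrib_right
          sum_distrib_left sum.swap[of _ UNIV B] mult_ac)
    show "(\<chi> u v. \<Sum>b\<in>B. b $ u * b $ v) *v x \<in> S" for x
      unfolding eq using B(1) by (auto intro!: subspace_sum subspace_scale S)
    fix x y assume "y \<in> S"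
    then have "y \<in> span B" using B(6) by simp
    then show "(x - (\<chi> u v. \<Sum>b\<in>B. b $ u * b $ v) *v x) \<bullet> y = 0"
    proof (induction rule: span_induct_alt)
      case (step c b y)
      have "(\<Sum>b'\<in>B. (b' \<bullet> x) * (b' \<bullet> b)) = (\<Sum>b'\<in>B. if b' = b then b \<bullet> x else 0)"
        using B(2) step(1) bb by (intro sum.cong refl) (auto simp: pairwise_def orthogonal_def)
      also have "\<dots> = b \<bullet> x" using fin step(1) by simp
      finally have "(x - (\<Sum>b\<in>B. (b \<bullet> x) *\<^sub>R b)) \<bullet> b = 0"
        by (simp add: inner_diff_left inner_sum_left) (simp add: inner_commute)
      then show ?case using step(2) by (simp add: eq inner_add_right)
    qed simp
  qed
  then have "P = (\<chi> u v. \<Sum>b\<in>B. b $ u * b $ v)"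
    using orthogonal_projection_eqI[OF S P] by simp
  then show ?thesis using that[OF fin B(5,1) bb] by simp
qed

section \<open>Diagonal entries of complementary projections\<close>

text \<open>
  The 1-periodic extension of \<open>t * (1 - t)\<close> is subadditive. This replaces the usual extreme point
  argument for minimising a concave function on a box with prescribed sum.
\<close>
lemma frac_parabola_add_le:
  fixes a b :: real
  shows "frac (a + b) * (1 - frac (a + b)) \<le> frac a * (1 - frac a) + frac b * (1 - frac b)"
proof -
  have "0 \<le> frac a * frac b" by simp
  moreover have "0 \<le> (1 - frac a) * (1 - frac b)"
    using frac_lt_1[of a] frac_lt_1[of b] by simp
  ultimately show ?thesis
    by (auto simp: frac_add algebra_simps)
qed

lemma frac_parabola_sum_le:
  fixes f :: "'a \<Rightarrow> real"
  shows "frac (\<Sum>i\<in>I. f i) * (1 - frac (\<Sum>i\<in>I. f i)) \<le> (\<Sum>i\<in>I. frac (f i) * (1 - frac (f i)))"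
proof (induction I rule: infinite_finite_induct)
  case (insert i I)
  then show ?case
    using frac_parabola_add_le[of "f i" "\<Sum>i\<in>I. f i"] by simp
qed simp_all

lemma sum_parabola_ge:
  fixes x :: "'a \<Rightarrow> real" and p n :: nat
  assumes x: "\<And>i. i \<in> I \<Longrightarrow> 0 \<le> x i" "\<And>i. i \<in> I \<Longrightarrow> x i \<le> c"
    and sum: "(\<Sum>i\<in>I. x i) = real p" and p: "0 < p" "p < n - 1" and c: "c = 1 - 1 / real n"
  shows "real p * (real n - 1 - real p) / (real n)\<^sup>2 \<le> (\<Sum>i\<in>I. x i * (c - x i))"
proof -
  have n: "real n > 1" and cpos: "0 < c" using p by (auto simp: c)
  have pn: "real p < real n - 1" using p by linarith
  have fr: "frac (x i / c) * (1 - frac (x i / c)) = x i / c * (1 - x i / c)" if "i \<in> I" for i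
  proof (cases "x i = c")
    case True
    then show ?thesis using cpos by simp
  next
    case False
    then have "frac (x i / c) = x i / c"
      using x[OF that] cpos by (subst frac_eq) auto
    then show ?thesis by simp
  qed
  have "real p / c = real p + real p / (real n - 1)"
    using n by (simp add: c field_simps)
  then have "frac (real p / c) = real p / (real n - 1)"
    using pn n by (simp add: frac_unique_iff)
  then have "real p / (real n - 1) * (1 - real p / (real n - 1)) \<le> (\<Sum>i\<in>I. x i / c * (1 - x i / c))"
    using frac_parabola_sum_le[where I = I and f = "\<lambda>i. x i / c"] sum fr
    by (simp add: sum_divide_distrib[symmetric] cong: sum.cong)
  then have "c\<^sup>2 * (real p / (real n - 1) * (1 - real p / (real n - 1)))
      \<le> c\<^sup>2 * (\<Sum>i\<in>I. x i / c * (1 - x i / c))"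
    by (intro mult_left_mono) auto
  also have "\<dots> = (\<Sum>i\<in>I. x i * (c - x i))"
    unfolding sum_distrib_left using cpos
    by (intro sum.cong refl) (simp add: field_simps power2_eq_square)
  also have "c\<^sup>2 * (real p / (real n - 1) * (1 - real p / (real n - 1)))
      = real p * (real n - 1 - real p) / (real n)\<^sup>2"
  proof -
    have "c = (real n - 1) / real n" using n by (simp add: c field_simps)
    then show ?thesis using n by (simp add: divide_simps power2_eq_square) algebra
  qed
  finally show ?thesis .
qed

text \<open>Here \<open>m = n - 1\<close>, and \<open>s\<close> is the deviation from the star vector.\<close>
lemma star_quartic_numeric:
  fixes m s :: real
  assumes m: "3 \<le> m" and s: "0 \<le> s" "s \<le> (m - 1) / m\<^sup>2"
  shows "8 * (1 - s) + 3 * (m + 1) * (m - 1) * s < (2 - s) * (m\<^sup>2 - m + 1)"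
proof -
  have co: "0 \<le> 4 * m\<^sup>2 - m - 10"
  proof -
    have "m * 3 \<le> m * m" using m by (intro mult_left_mono) auto
    then have "m * 3 \<le> m\<^sup>2" by (simp add: power2_eq_square)
    then show ?thesis using m by linarith
  qed
  have "s * (4 * m\<^sup>2 - m - 10) \<le> (m - 1) / m\<^sup>2 * (4 * m\<^sup>2 - m - 10)"
    by (rule mult_right_mono[OF s(2) co])
  also have "\<dots> < 2 * (m\<^sup>2 - m + 1) - 8"
  proof -
    define t where "t = m - 3"
    have t: "0 \<le> t" "m = t + 3" using m by (auto simp: t_def)
    have "(2 * (m\<^sup>2 - m + 1) - 8) * m\<^sup>2 - (m - 1) * (4 * m\<^sup>2 - m - 10)
        = 2 * t^4 + 18 * t^3 + 53 * t\<^sup>2 + 57 * t + 8"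
      unfolding t(2) by algebra
    moreover have "0 < 2 * t^4 + 18 * t^3 + 53 * t\<^sup>2 + 57 * t + 8"
      using t by (intro add_nonneg_pos) auto
    ultimately show ?thesis using m by (simp add: divide_simps)
  qed
  finally show ?thesis by (simp add: algebra_simps power2_eq_square)
qed

definition star_vector :: "'n \<Rightarrow> real^'n::finite" where
  "star_vector u = (\<chi> w. if w = u then real CARD('n) - 1 else - 1)"

text \<open>
  If the largest entry \<open>a\<close> of \<open>v\<close> has \<open>a\<^sup>2 < T\<close>, then \<open>(\<Sum>u. (v $ u)^4) \<le> a\<^sup>2\<close> suffices. Otherwise
  the other entries are expanded around their mean \<open>- h\<close>; their total squared deviation \<open>s\<close> is
  then so small that the loss in \<open>a^4\<close> outweighs their contribution.
\<close>
lemma sum_quartic_le: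
  fixes v :: "real^'n"
  assumes n: "4 \<le> CARD('n)" and v0: "(\<Sum>u\<in>UNIV. v $ u) = 0" and v1: "(\<Sum>u\<in>UNIV. (v $ u)\<^sup>2) = 1"
  defines "T \<equiv> 1 - (2 * real CARD('n) - 3) / (real CARD('n) * (real CARD('n) - 1))"
  shows "(\<Sum>u\<in>UNIV. (v $ u)^4) < T \<or>
    (\<Sum>u\<in>UNIV. (v $ u)^4) = T \<and> (\<exists>u c. v = c *\<^sub>R star_vector u)"
proof -
  define m where "m = real CARD('n) - 1"
  have nm: "real CARD('n) = m + 1" by (simp add: m_def)
  have m: "3 \<le> m" using n by (simp add: m_def)
  have T: "T = (m\<^sup>2 - m + 1) / ((m + 1) * m)"
    using m by (simp add: T_def nm divide_simps power2_eq_square) (simp add: algebra_simps)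
  have "Max (range (\<lambda>w. (v $ w)\<^sup>2)) \<in> range (\<lambda>w. (v $ w)\<^sup>2)"
    by (rule Max_in) auto
  then obtain u where u: "Max (range (\<lambda>w. (v $ w)\<^sup>2)) = (v $ u)\<^sup>2"
    by (rule imageE)
  have max: "(v $ w)\<^sup>2 \<le> (v $ u)\<^sup>2" for w
    unfolding u[symmetric] by (rule Max_ge) auto
  define a where "a = v $ u"
  have "(\<Sum>u\<in>UNIV. (v $ u)^4) \<le> (\<Sum>w\<in>UNIV. a\<^sup>2 * (v $ w)\<^sup>2)"
  proof (rule sum_mono)
    fix w
    have "(v $ w)^4 = (v $ w)\<^sup>2 * (v $ w)\<^sup>2" by algebra
    also have "\<dots> \<le> a\<^sup>2 * (v $ w)\<^sup>2" using max by (intro mult_right_mono) (auto simp: a_def)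
    finally show "(v $ w)^4 \<le> a\<^sup>2 * (v $ w)\<^sup>2" .
  qed
  then have q_le: "(\<Sum>u\<in>UNIV. (v $ u)^4) \<le> a\<^sup>2"
    by (simp add: sum_distrib_left[symmetric] v1)
  show ?thesis
  proof (cases "a\<^sup>2 < T")
    case True
    then show ?thesis using q_le by simp
  next
    case False
    define I where "I = UNIV - {u}"
    have cI: "real (card I) = m" using n by (simp add: I_def m_def of_nat_diff)
    have split: "(\<Sum>w\<in>UNIV. f w) = f u + (\<Sum>w\<in>I. f w)" for f :: "'n \<Rightarrow> real"
      by (simp add: I_def sum.remove[of UNIV u])
    define h where "h = a / m"
    define z where "z w = v $ w + h" for w
    define s where "s = (\<Sum>w\<in>I. (z w)\<^sup>2)"
    have a: "a = m * h" using m by (simp add: h_def)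
    have "(\<Sum>w\<in>I. v $ w) = - a" using v0 by (simp add: split a_def)
    then have z0: "(\<Sum>w\<in>I. z w) = 0"
      by (simp add: z_def sum.distrib cI a)
    have s0: "0 \<le> s" by (simp add: s_def sum_nonneg)
    have vz: "v $ w = z w - h" for w by (simp add: z_def)
    have "(\<Sum>w\<in>I. (v $ w)\<^sup>2) = (\<Sum>w\<in>I. (z w)\<^sup>2 - 2 * h * z w + h\<^sup>2)"
      by (intro sum.cong refl) (simp add: vz power2_eq_square algebra_simps)
    also have "\<dots> = s + m * h\<^sup>2"
      by (simp add: sum.distrib sum_subtractf sum_distrib_left[symmetric] z0 s_def cI)
    finally have s1: "m * (m + 1) * h\<^sup>2 = 1 - s"
      using v1 by (simp add: split a_def[symmetric] a algebra_simps power2_eq_square)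
    have h2: "h\<^sup>2 = (1 - s) / (m * (m + 1))" unfolding s1[symmetric] using m by simp
    have s_le: "s \<le> (m - 1) / m\<^sup>2"
    proof -
      have "(m\<^sup>2 - m + 1) / ((m + 1) * m) \<le> m\<^sup>2 * ((1 - s) / (m * (m + 1)))"
        using False by (simp add: T a h2 power_mult_distrib)
      then have "m\<^sup>2 - m + 1 \<le> m\<^sup>2 * (1 - s)"
        using m by (simp add: divide_simps mult_ac)
      then show ?thesis using m by (simp add: field_simps power2_eq_square)
    qed
    have zmax: "(z w)\<^sup>2 \<le> (m - 1) / m * s" if w: "w \<in> I" for w
    proof -
      have "(\<Sum>x\<in>I - {w}. z x) = - z w"
        using z0 w sum.remove[of I w z] by (simp add: I_def)
      moreover have "real (card (I - {w})) = m - 1"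
        using w cI m by (simp add: I_def m_def)
      moreover have "(\<Sum>x\<in>I - {w}. (z x)\<^sup>2) = s - (z w)\<^sup>2"
        using w sum.remove[of I w "\<lambda>x. (z x)\<^sup>2"] by (simp add: I_def s_def)
      ultimately have "(z w)\<^sup>2 \<le> (s - (z w)\<^sup>2) * (m - 1)"
        using sum_squared_le_sum_of_squares[of z "I - {w}"] by simp
      then show ?thesis using m by (simp add: field_simps)
    qed
    have tangent: "(v $ w)^4 \<le> h^4 - 4 * h^3 * z w + (z w)\<^sup>2 * (8 * h\<^sup>2 + 3 * ((m - 1) / m * s))"
      if w: "w \<in> I" for w
    proof -
      have "(2 * h - z w)\<^sup>2 \<le> 6 * h\<^sup>2 + 3 * (z w)\<^sup>2"
        using zero_le_power2[of "h + z w"] by (simp add: power2_eq_square algebra_simps)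
      then have "2 * h\<^sup>2 + (2 * h - z w)\<^sup>2 \<le> 8 * h\<^sup>2 + 3 * ((m - 1) / m * s)"
        using zmax[OF w] by linarith
      then have "(z w)\<^sup>2 * (2 * h\<^sup>2 + (2 * h - z w)\<^sup>2) \<le> (z w)\<^sup>2 * (8 * h\<^sup>2 + 3 * ((m - 1) / m * s))"
        by (intro mult_left_mono) auto
      moreover have "(v $ w)^4 = h^4 - 4 * h^3 * z w + (z w)\<^sup>2 * (2 * h\<^sup>2 + (2 * h - z w)\<^sup>2)"
        unfolding vz by algebra
      ultimately show ?thesis by linarith
    qed
    have "(\<Sum>w\<in>I. (v $ w)^4)
        \<le> (\<Sum>w\<in>I. h^4 - 4 * h^3 * z w + (z w)\<^sup>2 * (8 * h\<^sup>2 + 3 * ((m - 1) / m * s)))"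
      by (intro sum_mono tangent)
    also have "\<dots> = m * h^4 + s * (8 * h\<^sup>2 + 3 * ((m - 1) / m * s))"
      by (simp add: sum.distrib sum_subtractf sum_distrib_left[symmetric] sum_distrib_right[symmetric]
          z0 s_def[symmetric] cI)
    finally have q: "(\<Sum>w\<in>UNIV. (v $ w)^4)
        \<le> (m^4 + m) * (h\<^sup>2)\<^sup>2 + s * (8 * h\<^sup>2 + 3 * ((m - 1) / m * s))"
      by (simp add: split a_def[symmetric] a algebra_simps power_mult_distrib)
    have mm: "m * (m + 1) > 0" using m by simp
    have "T - ((m^4 + m) * (h\<^sup>2)\<^sup>2 + s * (8 * h\<^sup>2 + 3 * ((m - 1) / m * s)))
        = s / (m * (m + 1)) * ((2 - s) * (m\<^sup>2 - m + 1) - (8 * (1 - s) + 3 * (m + 1) * (m - 1) * s))"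
    proof -
      have e: "m^4 + m = m * (m + 1) * (m\<^sup>2 - m + 1)" by algebra
      show ?thesis unfolding T h2 e using m
        by (simp add: divide_simps) algebra
    qed
    then have Tq: "s / (m * (m + 1)) * ((2 - s) * (m\<^sup>2 - m + 1) - (8 * (1 - s) + 3 * (m + 1) * (m - 1) * s))
        \<le> T - (\<Sum>w\<in>UNIV. (v $ w)^4)"
      using q by linarith
    show ?thesis
    proof (cases "s = 0")
      case False
      then have "0 < s / (m * (m + 1)) *
          ((2 - s) * (m\<^sup>2 - m + 1) - (8 * (1 - s) + 3 * (m + 1) * (m - 1) * s))"
        using s0 mm star_quartic_numeric[OF m s0 s_le] by (intro mult_pos_pos) auto
      then show ?thesis using Tq by linarith
    next
      case True
      then have "\<forall>w\<in>I. (z w)\<^sup>2 = 0"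
        by (subst sum_nonneg_eq_0_iff[symmetric]) (auto simp: s_def I_def)
      then have vI: "v $ w = - h" if "w \<noteq> u" for w
        using that by (simp add: z_def I_def add_eq_0_iff2)
      then have veq: "v = h *\<^sub>R star_vector u"
        by (simp add: vec_eq_iff star_vector_def a_def[symmetric] a nm)
      then show ?thesis using Tq True by force
    qed
  qed
qed

lemma trace_orthogonal_projection:
  fixes P :: "real^'n^'n"
  assumes "subspace S" "is_orthogonal_projection P S"
  shows "trace P = real (dim S)" and "0 \<le> P $ u $ u"
proof -
  obtain B where B: "finite B" "card B = dim S" "\<And>b. b \<in> B \<Longrightarrow> b \<bullet> b = 1"
    "\<And>u v. P $ u $ v = (\<Sum>b\<in>B. b $ u * b $ v)"
    using orthogonal_projection_entries[OF assms] by metis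
  show "0 \<le> P $ u $ u" by (simp add: B(4) sum_nonneg)
  have "trace P = (\<Sum>b\<in>B. b \<bullet> b)"
    by (simp add: trace_def B(4) inner_vec_def sum.swap[of _ UNIV])
  then show "trace P = real (dim S)" using B by simp
qed

lemma rank_one_projection_diagonal:
  fixes P :: "real^'n^'n"
  assumes n: "4 \<le> CARD('n)" and S: "subspace S" and P: "is_orthogonal_projection P S"
    and one: "\<And>x. x \<in> S \<Longrightarrow> x \<bullet> 1 = 0" and dim: "dim S = 1"
  defines "c \<equiv> 1 - 1 / real CARD('n)"
    and "r \<equiv> (real CARD('n) - 2) / (real CARD('n) * (real CARD('n) - 1))"
  shows "r < (\<Sum>u\<in>UNIV. P $ u $ u * (c - P $ u $ u)) \<or>
    r = (\<Sum>u\<in>UNIV. P $ u $ u * (c - P $ u $ u)) \<and> (\<exists>u. S = span {star_vector u})"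
proof -
  obtain B where B: "finite B" "card B = 1" "B \<subseteq> S" "\<And>b. b \<in> B \<Longrightarrow> b \<bullet> b = 1"
    "\<And>u v. P $ u $ v = (\<Sum>b\<in>B. b $ u * b $ v)"
    using orthogonal_projection_entries[OF S P] dim by metis
  obtain b where b: "B = {b}" using B(2) card_1_singletonE by blast
  have Pb: "P $ u $ u = (b $ u)\<^sup>2" for u by (simp add: B(5) b power2_eq_square)
  have b0: "(\<Sum>u\<in>UNIV. b $ u) = 0" using one[of b] B(3) by (simp add: b inner_vec_def)
  have b1: "(\<Sum>u\<in>UNIV. (b $ u)\<^sup>2) = 1"
    using B(4)[of b] by (simp add: b inner_vec_def power2_eq_square)
  have "(\<Sum>u\<in>UNIV. P $ u $ u * (c - P $ u $ u)) = (\<Sum>u\<in>UNIV. c * (b $ u)\<^sup>2 - (b $ u)^4)"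
    unfolding Pb by (intro sum.cong refl) algebra
  also have "\<dots> = c - (\<Sum>u\<in>UNIV. (b $ u)^4)"
    by (simp add: sum_subtractf sum_distrib_left[symmetric] b1)
  finally have sum: "(\<Sum>u\<in>UNIV. P $ u $ u * (c - P $ u $ u)) = c - (\<Sum>u\<in>UNIV. (b $ u)^4)" .
  have r: "r = c - (1 - (2 * real CARD('n) - 3) / (real CARD('n) * (real CARD('n) - 1)))"
    using n by (simp add: r_def c_def divide_simps) (simp add: algebra_simps)
  have span: "S = span {star_vector u}" if "b = k *\<^sub>R star_vector u" for u k
  proof -
    have "k \<noteq> 0" using that B(4)[of b] b by auto
    then have "star_vector u = (1 / k) *\<^sub>R b" using that by simp
    then have "star_vector u \<in> S" using B(3) b S by (simp add: subspace_scale)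
    moreover have "star_vector u \<noteq> 0" using that B(4)[of b] b by auto
    ultimately show ?thesis
      using dim S by (intro subspace_dim_equal[symmetric]) (auto intro: span_minimal[THEN subsetD] simp: dim_singleton)
  qed
  show ?thesis
    using sum_quartic_le[OF n b0 b1] span unfolding sum r by fastforce
qed

definition mean_matrix :: "real^'n^'n" where
  "mean_matrix = (\<chi> u v. 1 / real CARD('n))"

lemma mean_matrix_mult: "mean_matrix *v x = ((x \<bullet> 1) / real CARD('n)) *\<^sub>R (1 :: real^'n)"
  by (simp add: mean_matrix_def vec_eq_iff matrix_vector_mult_def inner_vec_def sum_divide_distrib)

lemma complementary_projection:
  fixes P :: "real^'n^'n"
  assumes P: "is_orthogonal_projection P S" and one: "\<And>x. x \<in> S \<Longrightarrow> x \<bullet> 1 = 0"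
  defines "T \<equiv> {y. y \<bullet> 1 = 0 \<and> (\<forall>x\<in>S. x \<bullet> y = 0)}"
  shows "subspace T" and "is_orthogonal_projection (mat 1 - mean_matrix - P) T"
proof -
  show "subspace T" by (auto simp: subspace_def T_def inner_add_left inner_add_right)
  have eq: "(mat 1 - mean_matrix - P) *v x = x - ((x \<bullet> 1) / real CARD('n)) *\<^sub>R 1 - P *v x" for x
    by (simp add: matrix_vector_mult_diff_rdistrib mean_matrix_mult)
  have oo: "(1 :: real^'n) \<bullet> 1 = real CARD('n)" by (simp add: inner_vec_def)
  show "is_orthogonal_projection (mat 1 - mean_matrix - P) T"
  proof (rule is_orthogonal_projectionI)
    fix x
    have "y \<bullet> (x - P *v x) = 0" if "y \<in> S" for y
      using orthogonal_projection_diff[OF P that, of x] by (simp add: inner_commute)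
    then show "(mat 1 - mean_matrix - P) *v x \<in> T"
      using one[OF orthogonal_projection_in[OF P, of x]] one
      by (simp add: T_def eq inner_diff_left inner_diff_right oo)
    fix y assume y: "y \<in> T"
    have "(P *v x) \<bullet> y = 0" using y orthogonal_projection_in[OF P, of x] by (simp add: T_def)
    then show "(x - (mat 1 - mean_matrix - P) *v x) \<bullet> y = 0"
      using y by (simp add: T_def eq inner_add_left inner_commute[of 1 y])
  qed
qed

lemma projection_diagonal:
  fixes P :: "real^'n^'n"
  assumes n: "4 \<le> CARD('n)" and S: "subspace S" and P: "is_orthogonal_projection P S"
    and one: "\<And>x. x \<in> S \<Longrightarrow> x \<bullet> 1 = 0"
  defines "c \<equiv> 1 - 1 / real CARD('n)"
    and "r \<equiv> (real CARD('n) - 2) / (real CARD('n) * (real CARD('n) - 1))"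
    and "T \<equiv> {y. y \<bullet> 1 = 0 \<and> (\<forall>x\<in>S. x \<bullet> y = 0)}"
  assumes ne: "\<not> S \<subseteq> {0}" "\<not> T \<subseteq> {0}"
  shows "r < (\<Sum>u\<in>UNIV. P $ u $ u * (c - P $ u $ u)) \<or>
    r = (\<Sum>u\<in>UNIV. P $ u $ u * (c - P $ u $ u)) \<and>
    (\<exists>u. S = span {star_vector u} \<or> T = span {star_vector u})"
proof -
  let ?Q = "mat 1 - mean_matrix - P"
  have T: "subspace T" and Q: "is_orthogonal_projection ?Q T"
    using complementary_projection[OF P one] by (simp_all add: T_def)
  have Quu: "?Q $ u $ u = c - P $ u $ u" for u
    by (simp add: mat_def mean_matrix_def c_def)
  have "trace ?Q = (\<Sum>u\<in>UNIV. c - P $ u $ u)" by (simp only: trace_def Quu)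
  also have "\<dots> = real CARD('n) - 1 - trace P"
    by (simp add: sum_subtractf trace_def c_def right_diff_distrib)
  finally have dims: "real (dim S) + real (dim T) = real CARD('n) - 1"
    using trace_orthogonal_projection(1)[OF S P] trace_orthogonal_projection(1)[OF T Q] by simp
  have pos: "0 < dim S" "0 < dim T" using ne by (simp_all add: dim_eq_0[symmetric] del: dim_eq_0)
  have Tone: "\<And>x. x \<in> T \<Longrightarrow> x \<bullet> 1 = 0" by (simp add: T_def)
  consider "dim S = 1" | "dim T = 1" | "2 \<le> dim S" "2 \<le> dim T" using pos by linarith
  then show ?thesis
  proof cases
    case 1
    show ?thesis
      using rank_one_projection_diagonal[OF n S P one 1] unfolding c_def r_def by blast
  next
    case 2
    have "(\<Sum>u\<in>UNIV. ?Q $ u $ u * (c - ?Q $ u $ u)) = (\<Sum>u\<in>UNIV. P $ u $ u * (c - P $ u $ u))"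
      unfolding Quu by (simp add: mult.commute)
    then show ?thesis
      using rank_one_projection_diagonal[OF n T Q Tone 2] unfolding c_def[symmetric] r_def[symmetric]
      by auto
  next
    case 3
    let ?n = "real CARD('n)" and ?p = "real (dim S)" and ?q = "real (dim T)"
    have x: "0 \<le> P $ u $ u" "P $ u $ u \<le> c" for u
      using trace_orthogonal_projection(2)[OF S P, of u] trace_orthogonal_projection(2)[OF T Q, of u]
      unfolding Quu by simp_all
    have p: "dim S < CARD('n) - 1" using dims 3 by linarith
    have sum: "(\<Sum>u\<in>UNIV. P $ u $ u) = ?p"
      using trace_orthogonal_projection(1)[OF S P] by (simp add: trace_def)
    have ge: "?p * (?n - 1 - ?p) / ?n\<^sup>2 \<le> (\<Sum>u\<in>UNIV. P $ u $ u * (c - P $ u $ u))"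
      by (rule sum_parabola_ge[OF x sum pos(1) p c_def[THEN meta_eq_to_obj_eq]])
    have n5: "5 \<le> ?n" using dims 3 by linarith
    have pq: "2 * (?n - 3) \<le> ?p * (?n - 1 - ?p)"
    proof -
      have "0 \<le> (?p - 2) * (?q - 2)" using 3 by simp
      moreover have "?q = ?n - 1 - ?p" using dims by linarith
      ultimately show ?thesis by (simp add: algebra_simps)
    qed
    have "r < 2 * (?n - 3) / ?n\<^sup>2"
    proof -
      have "0 < (?n - 5) * (?n - 1) + 1" using n5 by (intro add_nonneg_pos) auto
      moreover have "0 < ?n * (?n - 1)" using n5 by simp
      ultimately show ?thesis
        using n5 by (simp add: r_def divide_simps power2_eq_square) (simp add: algebra_simps)
    qed
    also have "\<dots> \<le> ?p * (?n - 1 - ?p) / ?n\<^sup>2" using pq by (simp add: divide_right_mono)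
    finally show ?thesis using ge by linarith
  qed
qed

section \<open>Laplacians of connected graphs\<close>

definition is_star :: "'v \<Rightarrow> ('v, 'e) pre_digraph \<Rightarrow> bool" where
  "is_star u G \<longleftrightarrow> (\<forall>x y. x \<rightarrow>\<^bsub>G\<^esub> y \<longleftrightarrow> x \<noteq> y \<and> (x = u \<or> y = u))"

lemma (in graph) dominates_sym: "x \<rightarrow> y \<longleftrightarrow> y \<rightarrow> x"
  using arcs_ends_symmetric[OF sym_arcs] by blast

lemma (in graph) dominates_irrefl: "\<not> x \<rightarrow> x"
  by (auto simp: arcs_ends_conv dest: no_loops)

lemma (in graph) out_degree_eq_card: "out_degree G u = card {v. u \<rightarrow> v}"
proof -
  have "inj_on (head G) (out_arcs G u)"
    by (auto simp: inj_on_def out_arcs_def arc_to_ends_def intro!: no_multi_arcs)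
  moreover have "head G ` out_arcs G u = {v. u \<rightarrow> v}"
    by (auto simp: out_arcs_def arcs_ends_conv)
  ultimately show ?thesis by (metis card_image out_degree_def)
qed

lemma laplacian_mult:
  fixes G :: "('v::finite, 'e) pre_digraph"
  assumes "graph G"
  shows "(laplacian G *v x) $ u = (\<Sum>v | u \<rightarrow>\<^bsub>G\<^esub> v. x $ u - x $ v)"
proof -
  interpret graph G by fact
  have "(laplacian G *v x) $ u
      = (\<Sum>v\<in>UNIV. (if u = v then real (out_degree G u) * x $ v else 0) - (if u \<rightarrow>\<^bsub>G\<^esub> v then x $ v else 0))"
    unfolding laplacian_def matrix_vector_mult_def degree_matrix_def adjacency_matrix_def vec_lambda_beta
    by (intro sum.cong refl) (simp add: left_diff_distrib)
  also have "\<dots> = real (card {v. u \<rightarrow>\<^bsub>G\<^esub> v}) * x $ u - (\<Sum>v | u \<rightarrow>\<^bsub>G\<^esub> v. x $ v)"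
    by (simp add: sum_subtractf out_degree_eq_card sum.If_cases)
  finally show ?thesis by (simp add: sum_subtractf)
qed

lemma laplacian_one: "graph G \<Longrightarrow> laplacian G *v 1 = 0"
  by (simp add: vec_eq_iff laplacian_mult)

lemma laplacian_off_diagonal:
  "v \<noteq> w \<Longrightarrow> laplacian G $ v $ w = (if v \<rightarrow>\<^bsub>G\<^esub> w then - 1 else 0)"
  by (simp add: laplacian_def degree_matrix_def adjacency_matrix_def)

lemma laplacian_mult_axis:
  fixes G :: "('v::finite, 'e) pre_digraph"
  shows "(laplacian G *v axis w 1) $ v = laplacian G $ v $ w"
  by (simp add: matrix_vector_mult_basis column_def)

lemma connected_invariant:
  assumes "graph G" "verts G = UNIV" "Digraph_Component.connected G"
    and u: "P u" and step: "\<And>x y. P x \<Longrightarrow> x \<rightarrow>\<^bsub>G\<^esub> y \<Longrightarrow> P y"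
  shows "P w"
proof -
  interpret graph G by fact
  have "strongly_connected G"
    using assms symmetric_connected_imp_strongly_connected sym_arcs by blast
  then have "u \<rightarrow>\<^sup>*\<^bsub>G\<^esub> w" using assms(2) by (simp add: strongly_connected_def)
  then show ?thesis
    by (induction rule: reachable_induct) (use u step in auto)
qed

lemma laplacian_kernel:
  fixes G :: "('v::finite, 'e) pre_digraph"
  assumes G: "graph G" "verts G = UNIV" "Digraph_Component.connected G"
    and x: "laplacian G *v x = 0"
  shows "x $ v = x $ w"
proof -
  define M where "M = Max (range (($) x))"
  have le: "x $ v \<le> M" for v by (simp add: M_def)
  have "M \<in> range (($) x)" unfolding M_def by (rule Max_in) auto
  then obtain u where u: "x $ u = M" by auto
  have "x $ v = M" for v
  proof (rule connected_invariant[OF G, where P = "\<lambda>v. x $ v = M"])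
    fix y z assume y: "x $ y = M" and yz: "y \<rightarrow>\<^bsub>G\<^esub> z"
    have "(\<Sum>v | y \<rightarrow>\<^bsub>G\<^esub> v. x $ y - x $ v) = 0"
      using laplacian_mult[OF G(1), of x y] x by simp
    then have "\<forall>v\<in>{v. y \<rightarrow>\<^bsub>G\<^esub> v}. x $ y - x $ v = 0"
      using le y by (subst (asm) sum_nonneg_eq_0_iff) auto
    then show "x $ z = M" using yz y by simp
  qed (rule u)
  then show ?thesis by simp
qed

lemma spectral_projection_laplacian_zero:
  fixes G :: "('v::finite, 'e) pre_digraph"
  assumes G: "graph G" "verts G = UNIV" "Digraph_Component.connected G"
  shows "spectral_projection (laplacian G) 0 = mean_matrix"
proof (intro orthogonal_projection_eqI subspace_eigenspace is_orthogonal_projectionI)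
  show "mean_matrix *v x \<in> eigenspace (laplacian G) 0" for x
    by (simp add: eigenspace_def mean_matrix_mult matrix_vector_mult_scaleR laplacian_one G)
  fix x y :: "real^'v" assume "y \<in> eigenspace (laplacian G) 0"
  then have "y $ v = y $ undefined" for v
    using laplacian_kernel[OF G, of y] by (simp add: eigenspace_def)
  then have y: "y = y $ undefined *\<^sub>R 1" by (simp add: vec_eq_iff)
  have "(x - mean_matrix *v x) \<bullet> 1 = 0"
    by (simp add: mean_matrix_mult inner_diff_left) (simp add: inner_vec_def)
  then show "(x - mean_matrix *v x) \<bullet> y = 0" by (subst y) simp
qed

lemma complete_digraph_if_uniform:
  fixes G :: "('v::finite, 'e) pre_digraph"
  assumes G: "graph G" "verts G = UNIV" "Digraph_Component.connected G"
    and b: "\<And>v w. v \<noteq> w \<Longrightarrow> v \<rightarrow>\<^bsub>G\<^esub> w \<longleftrightarrow> b"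
  shows "complete_digraph CARD('v) G"
proof -
  interpret graph G by fact
  have "x \<rightarrow>\<^bsub>G\<^esub> y" if "x \<noteq> y" for x y
  proof (rule ccontr)
    assume "\<not> x \<rightarrow>\<^bsub>G\<^esub> y"
    then have "\<not> b" using b that by blast
    then have none: "\<not> v \<rightarrow>\<^bsub>G\<^esub> w" for v w using b dominates_irrefl by metis
    have "y = x" by (rule connected_invariant[OF G, where P = "\<lambda>v. v = x"]) (use none in auto)
    then show False using that by simp
  qed
  then have "arcs_ends G = {(u, v). (u, v) \<in> verts G \<times> verts G \<and> u \<noteq> v}"
    using dominates_irrefl G(2) by auto
  then show ?thesis using G by (simp add: complete_digraph_def)
qed

lemma two_nonzero_eigenvalues:
  fixes G :: "('v::finite, 'e) pre_digraph"
  assumes G: "graph G" "verts G = UNIV" "Digraph_Component.connected G"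
    and nc: "\<not> complete_digraph CARD('v) G"
  obtains \<theta> \<eta> where "\<theta> \<in> eigenvalues (laplacian G)" "\<eta> \<in> eigenvalues (laplacian G)"
    "\<theta> \<noteq> 0" "\<eta> \<noteq> 0" "\<theta> \<noteq> \<eta>"
proof (rule ccontr)
  let ?L = "laplacian G" let ?E = "\<lambda>\<mu>. spectral_projection ?L \<mu>"
  assume "\<not> thesis"
  then have "\<exists>\<theta>. \<forall>\<mu>\<in>eigenvalues ?L. \<mu> \<noteq> 0 \<longrightarrow> \<mu> = \<theta>" using that by blast
  then obtain \<theta> where \<theta>: "\<And>\<mu>. \<mu> \<in> eigenvalues ?L \<Longrightarrow> \<mu> \<noteq> 0 \<Longrightarrow> \<mu> = \<theta>" by blast
  have sym: "transpose ?L = ?L" by (rule transpose_laplacian[OF G(1)])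
  have L: "?L *v x = \<theta> *\<^sub>R (x - mean_matrix *v x)" for x
  proof -
    have x: "x = (\<Sum>\<mu>\<in>eigenvalues ?L. ?E \<mu> *v x)" by (rule sum_spectral_projection[OF sym, symmetric])
    have "1 \<in> eigenspace ?L 0" by (simp add: eigenspace_def laplacian_one G)
    then have 0: "0 \<in> eigenvalues ?L"
      by (auto simp: eigenspace_def eigenvalues_def intro!: exI[of _ 1])
    have "?L *v x = (\<Sum>\<mu>\<in>eigenvalues ?L. ?L *v (?E \<mu> *v x))"
      by (subst x) (simp add: linear_sum[OF matrix_vector_mul_linear])
    also have "\<dots> = (\<Sum>\<mu>\<in>eigenvalues ?L. \<theta> *\<^sub>R (?E \<mu> *v x) - (if \<mu> = 0 then \<theta> *\<^sub>R (?E 0 *v x) else 0))"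
    proof (intro sum.cong refl)
      fix \<mu> assume "\<mu> \<in> eigenvalues ?L"
      then show "?L *v (?E \<mu> *v x) = \<theta> *\<^sub>R (?E \<mu> *v x) - (if \<mu> = 0 then \<theta> *\<^sub>R (?E 0 *v x) else 0)"
        using orthogonal_projection_in[OF spectral_projection, of ?L \<mu> x] \<theta>[of \<mu>]
        by (auto simp: eigenspace_def)
    qed
    also have "\<dots> = \<theta> *\<^sub>R x - \<theta> *\<^sub>R (?E 0 *v x)"
      using 0 by (simp add: sum_subtractf scaleR_sum_right[symmetric] x[symmetric] finite_eigenvalues[OF sym])
    finally show ?thesis
      by (simp add: spectral_projection_laplacian_zero[OF G] scaleR_diff_right)
  qed
  have "v \<rightarrow>\<^bsub>G\<^esub> w \<longleftrightarrow> \<theta> \<noteq> 0" if "v \<noteq> w" for v w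
  proof -
    have "(axis w 1 :: real^'v) $ v = 0" using that by (simp add: axis_def)
    then have "?L $ v $ w = - \<theta> / real CARD('v)"
      using L[of "axis w 1"]
      by (simp add: laplacian_mult_axis[symmetric] mean_matrix_mult inner_axis')
    then show ?thesis using that by (auto simp: laplacian_off_diagonal split: if_splits)
  qed
  then show False using complete_digraph_if_uniform[OF G] nc by blast
qed

lemma star_if_eigenvectors:
  fixes G :: "('v::finite, 'e) pre_digraph"
  assumes G: "graph G" "verts G = UNIV" "Digraph_Component.connected G"
    and nc: "\<not> complete_digraph CARD('v) G"
    and u: "star_vector u \<in> eigenspace (laplacian G) \<theta>" "\<theta> \<noteq> 0"
    and ev: "\<And>w. w \<noteq> u \<Longrightarrow> \<exists>\<eta> \<alpha> \<beta>. axis w 1 + \<alpha> *\<^sub>R 1 + \<beta> *\<^sub>R star_vector u \<in> eigenspace (laplacian G) \<eta>"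
  shows "is_star u G"
proof -
  interpret graph G by fact
  let ?L = "laplacian G" let ?n = "real CARD('v)"
  have sv: "star_vector u = ?n *\<^sub>R axis u 1 - (1 :: real^'v)"
    by (simp add: vec_eq_iff star_vector_def axis_def)
  have Ls: "(?L *v star_vector u) $ v = ?n * ?L $ v $ u" for v
    by (simp add: sv matrix_vector_mult_diff_distrib matrix_vector_mult_scaleR laplacian_one G
        laplacian_mult_axis)
  have dom: "v \<rightarrow>\<^bsub>G\<^esub> u" if "v \<noteq> u" for v
  proof -
    have "?n * ?L $ v $ u = - \<theta>"
      using u(1) that by (simp add: Ls[symmetric] eigenspace_def star_vector_def)
    then show ?thesis using u(2) that by (auto simp: laplacian_off_diagonal split: if_splits)
  qed
  have const: "v \<rightarrow>\<^bsub>G\<^esub> w \<longleftrightarrow> v' \<rightarrow>\<^bsub>G\<^esub> w"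
    if wu: "w \<noteq> u" and vw: "v \<noteq> u" "v' \<noteq> u" "v \<noteq> w" "v' \<noteq> w" for v v' w
  proof -
    obtain \<eta> \<alpha> \<beta> where e: "axis w 1 + \<alpha> *\<^sub>R 1 + \<beta> *\<^sub>R star_vector u \<in> eigenspace ?L \<eta>"
      using ev[OF wu] by blast
    have "?L $ x $ w = \<beta> * ?n + \<eta> * (\<alpha> - \<beta>)" if "x \<noteq> u" "x \<noteq> w" for x
    proof -
      have "(?L *v (axis w 1 + \<alpha> *\<^sub>R 1 + \<beta> *\<^sub>R star_vector u)) $ x = \<eta> * (\<alpha> - \<beta>)"
        using e that by (simp add: eigenspace_def star_vector_def axis_def)
      moreover have "?L $ x $ u = -1" using that dom by (simp add: laplacian_off_diagonal)
      ultimately show ?thesis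
        by (simp add: matrix_vector_right_distrib matrix_vector_mult_scaleR laplacian_one G Ls
            laplacian_mult_axis)
    qed
    then have "?L $ v $ w = ?L $ v' $ w" using vw by simp
    then show ?thesis using vw by (simp add: laplacian_off_diagonal split: if_splits)
  qed
  have none: "\<not> a \<rightarrow>\<^bsub>G\<^esub> b" if ab: "a \<noteq> u" "b \<noteq> u" for a b
  proof
    assume e: "a \<rightarrow>\<^bsub>G\<^esub> b"
    then have "a \<noteq> b" using dominates_irrefl by blast
    have "x \<rightarrow>\<^bsub>G\<^esub> y" if "x \<noteq> y" for x y
    proof (cases "x = u \<or> y = u")
      case True
      then show ?thesis using dom that dominates_sym by metis
    next
      case False
      then have xy: "x \<noteq> u" "y \<noteq> u" by auto
      have to_b: "z \<rightarrow>\<^bsub>G\<^esub> b" if "z \<noteq> u" "z \<noteq> b" for z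
        using const[OF ab(2) ab(1) that(1) \<open>a \<noteq> b\<close> that(2)] e by simp
      show ?thesis
      proof (cases "y = b")
        case True
        then show ?thesis using to_b[OF xy(1)] that by simp
      next
        case False
        then have "b \<rightarrow>\<^bsub>G\<^esub> y" using to_b[OF xy(2)] dominates_sym by blast
        then show ?thesis using const[OF xy(2) ab(2) xy(1) _ that] False by simp
      qed
    qed
    then show False using complete_digraph_if_uniform[OF G, of True] nc by blast
  qed
  show ?thesis
    unfolding is_star_def using dom none dominates_sym dominates_irrefl by metis
qed

lemma three_vertices_star:
  fixes G :: "('v::finite, 'e) pre_digraph"
  assumes G: "graph G" "verts G = UNIV" "Digraph_Component.connected G"
    and nc: "\<not> complete_digraph CARD('v) G" and n: "CARD('v) \<le> 3"
  shows "\<exists>u. is_star u G"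
proof -
  interpret graph G by fact
  obtain a b where ab: "a \<noteq> b" "\<not> a \<rightarrow>\<^bsub>G\<^esub> b"
    using complete_digraph_if_uniform[OF G, of True] nc by blast
  have nb: "\<exists>y. x \<rightarrow>\<^bsub>G\<^esub> y" if "x \<noteq> z" for x z
  proof (rule ccontr)
    assume no: "\<nexists>y. x \<rightarrow>\<^bsub>G\<^esub> y"
    have "z = x" by (rule connected_invariant[OF G, where P = "\<lambda>v. v = x"]) (use no in auto)
    then show False using that by simp
  qed
  obtain u where u: "a \<rightarrow>\<^bsub>G\<^esub> u" using nb ab by blast
  then have ne: "u \<noteq> a" "u \<noteq> b" using ab dominates_irrefl by auto
  have "UNIV = {a, b, u}"
    using n ab ne by (intro card_seteq[symmetric]) auto
  then have all: "x = a \<or> x = b \<or> x = u" for x by blast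
  obtain y where "b \<rightarrow>\<^bsub>G\<^esub> y" using nb[of b a] ab(1) by blast
  then have "b \<rightarrow>\<^bsub>G\<^esub> u" using all[of y] ab dominates_irrefl dominates_sym by metis
  then have adj: "a \<rightarrow>\<^bsub>G\<^esub> u" "u \<rightarrow>\<^bsub>G\<^esub> a" "b \<rightarrow>\<^bsub>G\<^esub> u" "u \<rightarrow>\<^bsub>G\<^esub> b"
    and non: "\<not> a \<rightarrow>\<^bsub>G\<^esub> b" "\<not> b \<rightarrow>\<^bsub>G\<^esub> a"
    using u ab(2) dominates_sym by blast+
  have "x \<rightarrow>\<^bsub>G\<^esub> y \<longleftrightarrow> x \<noteq> y \<and> (x = u \<or> y = u)" for x y
    using all[of x] all[of y] adj non ne ab(1) by (elim disjE) (simp_all add: dominates_irrefl)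
  then have "is_star u G" by (simp add: is_star_def)
  then show ?thesis ..
qed

section \<open>The laziness bound\<close>

lemma sum_squares_le_square_sum:
  fixes f :: "'a \<Rightarrow> real"
  assumes I: "finite I" and f: "\<And>i. i \<in> I \<Longrightarrow> 0 \<le> f i"
  shows "(\<Sum>i\<in>I. (f i)\<^sup>2) \<le> (\<Sum>i\<in>I. f i)\<^sup>2"
    and "(\<Sum>i\<in>I. (f i)\<^sup>2) = (\<Sum>i\<in>I. f i)\<^sup>2 \<Longrightarrow> \<exists>j. \<forall>i\<in>I. i \<noteq> j \<longrightarrow> f i = 0"
proof -
  let ?F = "\<Sum>i\<in>I. f i"
  have eq: "?F\<^sup>2 - (\<Sum>i\<in>I. (f i)\<^sup>2) = (\<Sum>i\<in>I. f i * (?F - f i))"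
    by (simp add: right_diff_distrib sum_subtractf sum_distrib_right[symmetric] power2_eq_square)
  have rest: "?F - f i = (\<Sum>j\<in>I - {i}. f j)" if "i \<in> I" for i
    using sum.remove[OF I that, of f] by simp
  have nonneg: "0 \<le> f i * (?F - f i)" if "i \<in> I" for i
    unfolding rest[OF that] using f that by (intro mult_nonneg_nonneg sum_nonneg) auto
  then have "0 \<le> (\<Sum>i\<in>I. f i * (?F - f i))" by (rule sum_nonneg)
  then show "(\<Sum>i\<in>I. (f i)\<^sup>2) \<le> ?F\<^sup>2" using eq by linarith
  assume "(\<Sum>i\<in>I. (f i)\<^sup>2) = ?F\<^sup>2"
  then have zero: "\<forall>i\<in>I. f i * (?F - f i) = 0"
    using eq nonneg by (subst sum_nonneg_eq_0_iff[OF I, symmetric]) auto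
  show "\<exists>j. \<forall>i\<in>I. i \<noteq> j \<longrightarrow> f i = 0"
  proof (cases "\<exists>j\<in>I. f j \<noteq> 0")
    case True
    then obtain j where j: "j \<in> I" "f j \<noteq> 0" by blast
    then have "(\<Sum>i\<in>I - {j}. f i) = 0" using zero rest[OF j(1)] by auto
    then have "\<forall>i\<in>I - {j}. f i = 0"
      using f I by (subst (asm) sum_nonneg_eq_0_iff) auto
    then show ?thesis by (intro exI[of _ j]) auto
  qed auto
qed

lemma projection_axis_zero:
  fixes P :: "real^'n^'n"
  assumes P: "is_orthogonal_projection P S" and 0: "P $ u $ u = 0"
  shows "P *v axis u 1 = 0"
proof -
  have "(P *v axis u 1) \<bullet> (P *v axis u 1) = axis u 1 \<bullet> (P *v axis u 1)"
    by (rule inner_orthogonal_projection[OF P orthogonal_projection_in[OF P]])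
  also have "\<dots> = P $ u $ u"
    by (simp add: inner_axis' matrix_vector_mult_basis column_def)
  finally show ?thesis using 0 by simp
qed

definition star_laziness :: "nat \<Rightarrow> real" where
  "star_laziness n = real n - 2 + 2 / (real n * (real n - 1))"

lemma laziness_le_star:
  fixes G :: "('v::finite, 'e) pre_digraph"
  assumes G: "graph G" "verts G = UNIV" "Digraph_Component.connected G"
    and nc: "\<not> complete_digraph CARD('v) G" and n: "4 \<le> CARD('v)"
  shows "laziness G \<le> star_laziness CARD('v)"
    and "laziness G = star_laziness CARD('v) \<Longrightarrow> \<exists>u. is_star u G"
proof -
  let ?L = "laplacian G" let ?E = "\<lambda>\<mu>. spectral_projection ?L \<mu>" let ?n = "real CARD('v)"
  define c where "c = 1 - 1 / ?n"
  define r where "r = (?n - 2) / (?n * (?n - 1))"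
  have sym: "transpose ?L = ?L" by (rule transpose_laplacian[OF G(1)])
  have fin: "finite (eigenvalues ?L)" by (rule finite_eigenvalues[OF sym])
  have one: "1 \<in> eigenspace ?L 0" by (simp add: eigenspace_def laplacian_one G)
  then have ev0: "0 \<in> eigenvalues ?L"
    by (auto simp: eigenspace_def eigenvalues_def intro!: exI[of _ 1])
  obtain \<theta> \<eta> where ev: "\<theta> \<in> eigenvalues ?L" "\<eta> \<in> eigenvalues ?L" "\<theta> \<noteq> 0" "\<eta> \<noteq> 0" "\<theta> \<noteq> \<eta>"
    using two_nonzero_eigenvalues[OF G nc] by metis
  define R where "R = eigenvalues ?L - {0, \<theta>}"
  have split: "sum f (eigenvalues ?L) = f 0 + f \<theta> + sum f R" for f :: "real \<Rightarrow> 'x::ab_group_add"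
  proof -
    have "R = eigenvalues ?L - {0} - {\<theta>}" by (auto simp: R_def)
    then show ?thesis
      using sum.remove[OF fin ev0, of f] sum.remove[of "eigenvalues ?L - {0}" \<theta> f] fin ev
      by (simp add: add.assoc)
  qed
  define S where "S = eigenspace ?L \<theta>"
  define P where "P = ?E \<theta>"
  define T where "T = {y. y \<bullet> (1 :: real^'v) = 0 \<and> (\<forall>x\<in>S. x \<bullet> y = 0)}"
  have P: "is_orthogonal_projection P S" by (simp add: P_def S_def spectral_projection)
  have S: "subspace S" by (simp add: S_def subspace_eigenspace)
  have Sone: "x \<bullet> 1 = 0" if "x \<in> S" for x
    using orthogonal_eigenvectors[OF sym _ one ev(3), of x] that by (simp add: S_def)
  have sumE: "(\<Sum>\<mu>\<in>R. ?E \<mu> *v x) = x - mean_matrix *v x - P *v x" for x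
    using sum_spectral_projection[OF sym, of x]
    by (simp add: split P_def spectral_projection_laplacian_zero[OF G] algebra_simps)
  have sumdiag: "(\<Sum>\<mu>\<in>R. ?E \<mu> $ u $ u) = c - P $ u $ u" for u
    using arg_cong[OF sumE[of "axis u 1"], of "\<lambda>x. x $ u"]
    by (simp add: matrix_vector_mult_basis column_def mean_matrix_def c_def)
  have nonneg: "0 \<le> ?E \<mu> $ u $ u" for \<mu> u
    by (rule trace_orthogonal_projection[OF subspace_eigenspace spectral_projection])
  have finR: "finite R" using fin by (simp add: R_def)
  define D where "D u = (c - P $ u $ u)\<^sup>2 - (\<Sum>\<mu>\<in>R. (?E \<mu> $ u $ u)\<^sup>2)" for u
  have D: "0 \<le> D u" for u
    using sum_squares_le_square_sum(1)[OF finR, of "\<lambda>\<mu>. ?E \<mu> $ u $ u"] nonneg by (simp add: D_def sumdiag)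
  define Z where "Z = (\<Sum>u\<in>UNIV. P $ u $ u * (c - P $ u $ u))"
  have "laziness G = (\<Sum>u\<in>UNIV. \<Sum>\<mu>\<in>eigenvalues ?L. (?E \<mu> $ u $ u)\<^sup>2)"
    unfolding laziness_eq by (rule sum.swap)
  also have "\<dots> = (\<Sum>u\<in>UNIV. (1 / ?n)\<^sup>2 + c\<^sup>2 - 2 * (P $ u $ u * (c - P $ u $ u)) - D u)"
  proof (intro sum.cong refl)
    fix u
    have "(\<Sum>\<mu>\<in>eigenvalues ?L. (?E \<mu> $ u $ u)\<^sup>2) = (1 / ?n)\<^sup>2 + (P $ u $ u)\<^sup>2 + (\<Sum>\<mu>\<in>R. (?E \<mu> $ u $ u)\<^sup>2)"
      by (simp add: split spectral_projection_laplacian_zero[OF G] P_def mean_matrix_def)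
    then show "(\<Sum>\<mu>\<in>eigenvalues ?L. (?E \<mu> $ u $ u)\<^sup>2)
        = (1 / ?n)\<^sup>2 + c\<^sup>2 - 2 * (P $ u $ u * (c - P $ u $ u)) - D u"
      by (simp add: D_def power2_eq_square algebra_simps)
  qed
  also have "\<dots> = ?n * ((1 / ?n)\<^sup>2 + c\<^sup>2) - 2 * Z - (\<Sum>u\<in>UNIV. D u)"
    by (simp add: Z_def sum_subtractf sum_distrib_left[symmetric] del: sum.distrib)
  also have "?n * ((1 / ?n)\<^sup>2 + c\<^sup>2) = star_laziness CARD('v) + 2 * r"
    using n by (simp add: star_laziness_def c_def r_def divide_simps power2_eq_square)
      (simp add: algebra_simps)
  finally have laz: "laziness G = star_laziness CARD('v)
      - 2 * (Z - r) - (\<Sum>u\<in>UNIV. D u)"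
    by simp
  have ex: "\<exists>x\<in>eigenspace ?L \<mu>. x \<noteq> 0" if "\<mu> \<in> eigenvalues ?L" for \<mu>
    using that by (auto simp: eigenvalues_def eigenspace_def)
  have etaT: "eigenspace ?L \<eta> \<subseteq> T"
    using orthogonal_eigenvectors[OF sym] one ev by (auto simp: T_def S_def)
  have neS: "\<not> S \<subseteq> {0}" using ex[OF ev(1)] by (auto simp: S_def)
  have neT: "\<not> T \<subseteq> {0}" using ex[OF ev(2)] etaT by auto
  have diag: "r < Z \<or>
      r = Z \<and>
      (\<exists>u. S = span {star_vector u} \<or> T = span {star_vector u})"
    using projection_diagonal[OF n S P Sone, folded c_def r_def T_def, folded Z_def] neS neT by blast
  then have r_le: "r \<le> Z" by auto
  have sumD: "0 \<le> (\<Sum>u\<in>UNIV. D u)" using D by (simp add: sum_nonneg)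
  show "laziness G \<le> star_laziness CARD('v)" using laz r_le sumD by argo
  assume eq: "laziness G = star_laziness CARD('v)"
  then have "(\<Sum>u\<in>UNIV. D u) = 0" and "\<not> r < Z"
    using laz r_le sumD by argo+
  then obtain u where u: "S = span {star_vector u} \<or> T = span {star_vector u}" using diag by blast
  have D0: "D w = 0" for w
    using \<open>(\<Sum>u\<in>UNIV. D u) = 0\<close> D by (subst (asm) sum_nonneg_eq_0_iff) auto
  have "is_star u G"
    using u
  proof
    assume Su: "S = span {star_vector u}"
    have "star_vector u \<in> eigenspace ?L \<theta>" using Su span_base[of _ "{star_vector u}"] by (simp add: S_def)
    then show "is_star u G"
    proof (rule star_if_eigenvectors[OF G nc _ ev(3)])
      fix w
      have "(\<Sum>\<mu>\<in>R. (?E \<mu> $ w $ w)\<^sup>2) = (\<Sum>\<mu>\<in>R. ?E \<mu> $ w $ w)\<^sup>2"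
        using D0[of w] by (simp add: D_def sumdiag)
      then obtain \<nu> where \<nu>: "\<forall>\<mu>\<in>R. \<mu> \<noteq> \<nu> \<longrightarrow> ?E \<mu> $ w $ w = 0"
        using sum_squares_le_square_sum(2)[OF finR, of "\<lambda>\<mu>. ?E \<mu> $ w $ w"] nonneg by metis
      have "(\<Sum>\<mu>\<in>R. ?E \<mu> *v axis w 1) = (\<Sum>\<mu>\<in>R. if \<mu> = \<nu> then ?E \<nu> *v axis w 1 else 0)"
        using \<nu> by (intro sum.cong refl) (auto intro: projection_axis_zero[OF spectral_projection])
      then have "(\<Sum>\<mu>\<in>R. ?E \<mu> *v axis w 1) \<in> eigenspace ?L \<nu>"
        using finR by (auto simp: orthogonal_projection_in[OF spectral_projection]
            subspace_0[OF subspace_eigenspace])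
      moreover obtain k where "P *v axis w 1 = k *\<^sub>R star_vector u"
        using orthogonal_projection_in[OF P, of "axis w 1"] by (auto simp: Su span_singleton)
      ultimately have "axis w 1 + (- 1 / ?n) *\<^sub>R 1 + (- k) *\<^sub>R star_vector u \<in> eigenspace ?L \<nu>"
        by (simp add: sumE mean_matrix_mult inner_axis' algebra_simps)
      then show "\<exists>\<eta> \<alpha> \<beta>. axis w 1 + \<alpha> *\<^sub>R 1 + \<beta> *\<^sub>R star_vector u \<in> eigenspace ?L \<eta>"
        by blast
    qed
  next
    assume Tu: "T = span {star_vector u}"
    obtain x where x: "x \<in> eigenspace ?L \<eta>" "x \<noteq> 0" using ex[OF ev(2)] by blast
    then obtain k where k: "x = k *\<^sub>R star_vector u" using etaT by (auto simp: Tu span_singleton)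
    then have "star_vector u = (1 / k) *\<^sub>R x" using x(2) by simp
    then have "star_vector u \<in> eigenspace ?L \<eta>"
      using x(1) by (simp add: subspace_scale[OF subspace_eigenspace])
    then show "is_star u G"
    proof (rule star_if_eigenvectors[OF G nc _ ev(4)])
      fix w
      have "(mat 1 - mean_matrix - P) *v axis w 1 \<in> T"
        using orthogonal_projection_in[OF complementary_projection(2)[OF P Sone]]
        by (simp add: T_def)
      then obtain k where "(mat 1 - mean_matrix - P) *v axis w 1 = k *\<^sub>R star_vector u"
        by (auto simp: Tu span_singleton)
      then have "axis w 1 + (- 1 / ?n) *\<^sub>R 1 + (- k) *\<^sub>R star_vector u = P *v axis w 1"
        by (simp add: matrix_vector_mult_diff_rdistrib mean_matrix_mult inner_axis' algebra_simps)
      then show "\<exists>\<eta> \<alpha> \<beta>. axis w 1 + \<alpha> *\<^sub>R 1 + \<beta> *\<^sub>R star_vector u \<in> eigenspace ?L \<eta>"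
        using orthogonal_projection_in[OF P, of "axis w 1"] unfolding S_def by metis
    qed
  qed
  then show "\<exists>u. is_star u G" ..
qed

section \<open>Stars\<close>

lemma laplacian_star:
  fixes G :: "('v::finite, 'e) pre_digraph"
  assumes G: "graph G" and u: "is_star u G"
  shows "laplacian G *v x = x - x $ u *\<^sub>R 1 + (star_vector u \<bullet> x) *\<^sub>R axis u 1"
proof -
  have sx: "star_vector u \<bullet> x = (\<Sum>v\<in>UNIV. x $ u - x $ v)"
  proof -
    have "star_vector u \<bullet> x = (\<Sum>v\<in>UNIV. (if v = u then real CARD('v) * x $ v else 0) - x $ v)"
      by (simp only: inner_vec_def star_vector_def) (intro sum.cong, auto simp: algebra_simps)
    also have "\<dots> = real CARD('v) * x $ u - (\<Sum>v\<in>UNIV. x $ v)"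
      by (simp add: sum_subtractf)
    finally show ?thesis by (simp add: sum_subtractf)
  qed
  have "(laplacian G *v x) $ w = (x - x $ u *\<^sub>R 1 + (star_vector u \<bullet> x) *\<^sub>R axis u 1) $ w" for w
  proof (cases "w = u")
    case True
    have "(\<Sum>v | u \<rightarrow>\<^bsub>G\<^esub> v. x $ u - x $ v) = (\<Sum>v\<in>UNIV. x $ u - x $ v)"
      using u by (intro sum.mono_neutral_left) (auto simp: is_star_def)
    then show ?thesis using True by (simp add: laplacian_mult[OF G] sx axis_def)
  next
    case False
    then have "{v. w \<rightarrow>\<^bsub>G\<^esub> v} = {u}" using u by (auto simp: is_star_def)
    then show ?thesis using False by (simp add: laplacian_mult[OF G] axis_def)
  qed
  then show ?thesis by (simp add: vec_eq_iff)
qed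

lemma laziness_star:
  fixes G :: "('v::finite, 'e) pre_digraph"
  assumes G: "graph G" and u: "is_star u G" and n: "3 \<le> CARD('v)"
  shows "laziness G = star_laziness CARD('v)"
proof -
  let ?L = "laplacian G" let ?n = "real CARD('v)"
  let ?s = "star_vector u :: real^'v"
  define P :: "real^'v^'v" where "P = (\<chi> v w. ?s $ v * ?s $ w / (?n * (?n - 1)))"
  define M where "M \<mu> = (if \<mu> = 0 then mean_matrix else if \<mu> = ?n then P else mat 1 - mean_matrix - P)" for \<mu>
  have sym: "transpose ?L = ?L" by (rule transpose_laplacian[OF G])
  have n1: "3 \<le> ?n" using n by simp
  have P: "P *v x = ((?s \<bullet> x) / (?n * (?n - 1))) *\<^sub>R ?s" for x
    by (simp add: P_def vec_eq_iff matrix_vector_mult_def inner_vec_def sum_divide_distrib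
        sum_distrib_right sum_distrib_left mult_ac)
  have sv: "?s = ?n *\<^sub>R axis u 1 - 1"
    by (simp add: vec_eq_iff star_vector_def axis_def)
  have s1: "?s \<bullet> 1 = 0"
    by (simp add: sv inner_diff_left inner_axis') (simp add: inner_vec_def)
  have su: "?s $ u = ?n - 1" by (simp add: star_vector_def)
  have ss: "?s \<bullet> ?s = ?n * (?n - 1)"
    by (subst (1) sv) (simp add: inner_diff_left inner_axis' su inner_commute[of 1] s1)
  have Ls: "?L *v ?s = ?n *\<^sub>R ?s"
    unfolding laplacian_star[OF G u] ss su
    by (simp add: vec_eq_iff star_vector_def axis_def algebra_simps)
  have Lx: "?L *v x = x" if "?s \<bullet> x = 0" "x \<bullet> 1 = 0" for x
  proof -
    have "1 \<bullet> x = 0" using that(2) by (simp add: inner_commute)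
    then have "?n * x $ u = 0" using that(1) by (simp add: sv inner_diff_left inner_axis')
    then show ?thesis by (simp add: laplacian_star[OF G u] that)
  qed
  have Mdef: "M 0 = mean_matrix" "M ?n = P" "M 1 = mat 1 - mean_matrix - P"
    using n1 by (auto simp: M_def)
  have distinct: "?n \<noteq> 1" "?n \<noteq> 0" using n1 by auto
  have eig: "?L *v (M \<mu> *v x) = \<mu> *\<^sub>R (M \<mu> *v x)" if "\<mu> \<in> {0, ?n, 1}" for \<mu> x
  proof -
    have "?L *v (mean_matrix *v x) = 0"
      by (simp add: mean_matrix_mult matrix_vector_mult_scaleR laplacian_one[OF G])
    moreover have "?L *v (P *v x) = ?n *\<^sub>R (P *v x)"
      by (simp add: P matrix_vector_mult_scaleR Ls)
    moreover have "?L *v ((mat 1 - mean_matrix - P) *v x) = (mat 1 - mean_matrix - P) *v x"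
    proof (rule Lx)
      have eq: "(mat 1 - mean_matrix - P) *v x
          = x - ((x \<bullet> 1) / ?n) *\<^sub>R 1 - ((?s \<bullet> x) / (?n * (?n - 1))) *\<^sub>R ?s"
        by (simp add: matrix_vector_mult_diff_rdistrib mean_matrix_mult P)
      show "?s \<bullet> ((mat 1 - mean_matrix - P) *v x) = 0"
        using n1 by (simp add: eq inner_diff_right s1 ss)
      have "(1 :: real^'v) \<bullet> 1 = ?n" by (simp add: inner_vec_def)
      then show "((mat 1 - mean_matrix - P) *v x) \<bullet> 1 = 0"
        using n1 by (simp add: eq inner_diff_left s1)
    qed
    ultimately show ?thesis using that Mdef by auto
  qed
  have diag: "P $ v $ v = (if v = u then (?n - 1) / ?n else 1 / (?n * (?n - 1)))" for v
    using n1 by (simp add: P_def star_vector_def)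
  have diagM: "(mat 1 - mean_matrix - P) $ v $ v = (if v = u then 0 else (?n - 2) / (?n - 1))" for v
    using n1 by (simp add: mat_def mean_matrix_def diag divide_simps) (simp add: algebra_simps)
  obtain w where w: "w \<noteq> u"
  proof -
    have "UNIV \<noteq> {u}"
    proof
      assume "UNIV = {u}"
      then have "CARD('v) = card {u}" by (rule arg_cong)
      then show False using n by simp
    qed
    then show ?thesis using that by blast
  qed
  have nz: "M \<mu> \<noteq> 0" if "\<mu> \<in> {0, ?n, 1}" for \<mu>
  proof -
    have "(mean_matrix :: real^'v^'v) $ u $ u \<noteq> 0" by (simp add: mean_matrix_def)
    moreover have "P $ u $ u \<noteq> 0" using n1 by (simp add: diag)
    moreover have "(mat 1 - mean_matrix - P) $ w $ w \<noteq> 0" unfolding diagM using n1 w by simp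
    ultimately have "mean_matrix \<noteq> (0 :: real^'v^'v)" "P \<noteq> 0" "mat 1 - mean_matrix - P \<noteq> 0"
      by (metis zero_index)+
    then show ?thesis using that Mdef by auto
  qed
  have id: "(\<Sum>\<mu>\<in>{0, ?n, 1}. M \<mu> *v x) = x" for x
    using distinct by (simp add: Mdef matrix_vector_mult_diff_rdistrib)
  note dec = spectral_decomposition_unique[OF sym _ eig nz id]
  have E: "eigenvalues ?L = {0, ?n, 1}" by (rule dec(1)) auto
  have SP: "spectral_projection ?L \<mu> = M \<mu>" if "\<mu> \<in> {0, ?n, 1}" for \<mu>
    by (rule dec(2)) (use that in auto)
  have "laziness G = (\<Sum>\<mu>\<in>{0, ?n, 1}. \<Sum>v\<in>UNIV. (M \<mu> $ v $ v)\<^sup>2)"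
    unfolding laziness_eq E by (intro sum.cong refl) (simp only: SP)
  also have "\<dots> = (\<Sum>v\<in>(UNIV :: 'v set). (1 / ?n)\<^sup>2) + (\<Sum>v\<in>UNIV. (P $ v $ v)\<^sup>2)
      + (\<Sum>v\<in>UNIV. ((mat 1 - mean_matrix - P) $ v $ v)\<^sup>2)"
    using distinct by (simp add: Mdef mean_matrix_def)
  also have "(\<Sum>v\<in>UNIV. (P $ v $ v)\<^sup>2) = ((?n - 1) / ?n)\<^sup>2 + (?n - 1) * (1 / (?n * (?n - 1)))\<^sup>2"
    using n by (simp add: diag sum.remove[of UNIV u] of_nat_diff)
  also have "(\<Sum>v\<in>UNIV. ((mat 1 - mean_matrix - P) $ v $ v)\<^sup>2) = (?n - 1) * ((?n - 2) / (?n - 1))\<^sup>2"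
    unfolding diagM using n by (simp add: sum.remove[of UNIV u] of_nat_diff)
  also have "(\<Sum>v\<in>(UNIV :: 'v set). (1 / ?n)\<^sup>2) + (((?n - 1) / ?n)\<^sup>2 + (?n - 1) * (1 / (?n * (?n - 1)))\<^sup>2)
      + (?n - 1) * ((?n - 2) / (?n - 1))\<^sup>2 = star_laziness CARD('v)"
    using n1 by (simp add: star_laziness_def divide_simps power2_eq_square) algebra
  finally show ?thesis .
qed

lemma digraph_isoI:
  fixes G :: "('a, 'b) pre_digraph" and H :: "('c, 'd) pre_digraph"
  assumes G: "graph G" "graph H" and f: "bij_betw f (verts G) (verts H)"
    and adj: "\<And>x y. x \<in> verts G \<Longrightarrow> y \<in> verts G \<Longrightarrow> x \<rightarrow>\<^bsub>G\<^esub> y \<longleftrightarrow> f x \<rightarrow>\<^bsub>H\<^esub> f y"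
  shows "digraph_iso G H"
proof -
  interpret G: graph G by fact
  interpret H: graph H by fact
  define g where "g a = (SOME b. b \<in> arcs H \<and> tail H b = f (tail G a) \<and> head H b = f (head G a))" for a
  have g: "g a \<in> arcs H" "tail H (g a) = f (tail G a)" "head H (g a) = f (head G a)"
    if "a \<in> arcs G" for a
  proof -
    have "tail G a \<rightarrow>\<^bsub>G\<^esub> head G a" using that by (auto simp: arcs_ends_conv)
    then have "f (tail G a) \<rightarrow>\<^bsub>H\<^esub> f (head G a)" using that adj by simp
    then have "\<exists>b. b \<in> arcs H \<and> tail H b = f (tail G a) \<and> head H b = f (head G a)"
      by (auto simp: arcs_ends_conv)
    from someI_ex[OF this] show "g a \<in> arcs H" "tail H (g a) = f (tail G a)" "head H (g a) = f (head G a)"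
      by (auto simp: g_def)
  qed
  have inj: "inj_on f (verts G)" and im: "f ` verts G = verts H"
    using f by (auto simp: bij_betw_def)
  have inj_g: "inj_on g (arcs G)"
  proof (rule inj_onI)
    fix a b assume ab: "a \<in> arcs G" "b \<in> arcs G" "g a = g b"
    then have "f (tail G a) = f (tail G b)" "f (head G a) = f (head G b)"
      using g by metis+
    then have "arc_to_ends G a = arc_to_ends G b"
      using inj ab by (simp add: arc_to_ends_def inj_on_eq_iff)
    then show "a = b" using G.no_multi_arcs ab by blast
  qed
  have im_g: "g ` arcs G = arcs H"
  proof (intro equalityI subsetI)
    fix e assume e: "e \<in> arcs H"
    then have "tail H e \<in> f ` verts G" "head H e \<in> f ` verts G" by (simp_all add: im)
    then obtain x y where xy: "x \<in> verts G" "y \<in> verts G" "tail H e = f x" "head H e = f y" by blast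
    have "tail H e \<rightarrow>\<^bsub>H\<^esub> head H e" using e by (auto simp: arcs_ends_conv)
    then have "x \<rightarrow>\<^bsub>G\<^esub> y" using adj xy by simp
    then obtain a where a: "a \<in> arcs G" "tail G a = x" "head G a = y" by (auto simp: arcs_ends_conv)
    then have "arc_to_ends H (g a) = arc_to_ends H e" by (simp add: arc_to_ends_def g xy)
    then have "g a = e" using H.no_multi_arcs g(1)[OF a(1)] e by blast
    then show "e \<in> g ` arcs G" using a(1) by blast
  qed (use g in auto)
  define h where "h = \<lparr>iso_verts = f, iso_arcs = g, iso_head = head H, iso_tail = tail H\<rparr>"
  have "G.digraph_isomorphism h"
    by (simp add: G.digraph_isomorphism_def h_def inj inj_g g G.wf_digraph)
  moreover have "H = app_iso h G" by (simp add: app_iso_def h_def im im_g)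
  ultimately show ?thesis by (auto simp: digraph_iso_def)
qed

lemma digraph_iso_star:
  fixes G :: "('v, 'e) pre_digraph" and H :: "('w, 'f) pre_digraph"
  assumes iso: "digraph_iso G H" and V: "verts G = UNIV" "verts H = UNIV" and w: "is_star w H"
  shows "\<exists>u. is_star u G"
proof -
  obtain h where h: "pre_digraph.digraph_isomorphism G h" "H = app_iso h G"
    using iso by (auto simp: digraph_iso_def)
  let ?f = "iso_verts h"
  have inj: "inj ?f" using h(1) V by (simp add: pre_digraph.digraph_isomorphism_def)
  have "?f ` UNIV = UNIV" using h(2) V by (metis verts_app_iso)
  then obtain u where u: "?f u = w" by (metis surjD)
  have ends: "arcs_ends H = (\<lambda>(x, y). (?f x, ?f y)) ` arcs_ends G"
    using h by (auto simp: arcs_ends_conv pre_digraph.digraph_isomorphism_def image_iff)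
  have "x \<rightarrow>\<^bsub>G\<^esub> y \<longleftrightarrow> ?f x \<rightarrow>\<^bsub>H\<^esub> ?f y" for x y
    using inj by (auto simp: ends inj_eq)
  then have "is_star u G"
    using w u[symmetric] inj by (simp add: is_star_def inj_eq)
  then show ?thesis ..
qed

lemma complete_bipartite_star:
  fixes G :: "('v::finite, 'e) pre_digraph"
  assumes G: "complete_bipartite_digraph 1 (n - 1) G" "verts G = UNIV" and n: "0 < n"
  shows "\<exists>u. is_star u G" and "CARD('v) = n"
proof -
  have "\<exists>U V. verts G = U \<union> V \<and> U \<inter> V = {} \<and> card U = 1 \<and> card V = n - 1 \<and>
      arcs_ends G = U \<times> V \<union> V \<times> U"
    using G(1) by (simp only: complete_bipartite_digraph_def)
  then obtain U where "\<exists>V. verts G = U \<union> V \<and> U \<inter> V = {} \<and> card U = 1 \<and> card V = n - 1 \<and>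
      arcs_ends G = U \<times> V \<union> V \<times> U" ..
  then obtain V where UV: "verts G = U \<union> V \<and> U \<inter> V = {} \<and> card U = 1 \<and> card V = n - 1 \<and>
      arcs_ends G = U \<times> V \<union> V \<times> U" ..
  then obtain u where u: "U = {u}" by (metis card_1_singletonE)
  have "v \<in> V \<longleftrightarrow> v \<noteq> u" for v
  proof -
    have "v \<in> U \<union> V" using UV G(2) by (metis UNIV_I)
    then show ?thesis using UV u by auto
  qed
  then have V: "V = - {u}" by auto
  have "arcs_ends G = {u} \<times> (- {u}) \<union> (- {u}) \<times> {u}" using UV u V by metis
  then have "is_star u G" by (auto simp: is_star_def)
  then show "\<exists>u. is_star u G" ..
  have "card V = CARD('v) - 1" unfolding V by (simp add: Compl_eq_Diff_UNIV card_Diff_singleton)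
  then have "CARD('v) - 1 = n - 1" using UV by metis
  moreover have "0 < CARD('v)" by simp
  ultimately show "CARD('v) = n" using n by linarith
qed

theorem theorem3p2:
  fixes X :: "('v::finite, 'e) pre_digraph"
    and S :: "('w::finite, 'f) pre_digraph"
    and n :: nat
  assumes "graph X" and "verts X = UNIV" and "card (verts X) = n"
    and "Digraph_Component.connected X"
    and "\<not> complete_digraph n X"
    and "complete_bipartite_digraph 1 (n - 1) S" and "verts S = UNIV"
  shows "laziness X \<le> laziness S \<and> (laziness X = laziness S \<longleftrightarrow> digraph_iso X S)"
proof -
  have n: "CARD('v) = n" using assms(2,3) by simp
  have nc: "\<not> complete_digraph CARD('v) X" using assms(5) n by simp
  note X = assms(1,2,4)
  have S: "graph S" using assms(6) by (simp add: complete_bipartite_digraph_def)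
  have n0: "0 < n" using n by auto
  obtain w where w: "is_star w S" using complete_bipartite_star(1)[OF assms(6,7) n0] by blast
  have nS: "CARD('w) = n" by (rule complete_bipartite_star(2)[OF assms(6,7) n0])
  have n3: "3 \<le> n"
  proof (rule ccontr)
    interpret graph X by (rule assms(1))
    assume n2: "\<not> 3 \<le> n"
    then have "CARD('v) \<le> 3" using n by simp
    from three_vertices_star[OF X nc this] obtain u where u: "is_star u X" ..
    have two: "v = w" if "v \<noteq> u" "w \<noteq> u" for v w
    proof (rule ccontr)
      assume "v \<noteq> w"
      then have "card {u, v, w} = 3" using that by simp
      then show False using card_mono[of UNIV "{u, v, w}"] n n2 by simp
    qed
    have "v \<rightarrow>\<^bsub>X\<^esub> w \<longleftrightarrow> True" if "v \<noteq> w" for v w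
      using u two[of v w] that by (auto simp: is_star_def)
    then show False using complete_digraph_if_uniform[OF X] nc by blast
  qed
  have lazS: "laziness S = star_laziness n"
    using laziness_star[OF S w] n3 by (simp add: nS)
  have star: "laziness X = laziness S" if "is_star u X" for u
    using laziness_star[OF assms(1) that] n3 by (simp add: n lazS)
  have main: "laziness X \<le> laziness S \<and> (laziness X = laziness S \<longrightarrow> (\<exists>u. is_star u X))"
  proof (cases "n = 3")
    case True
    then show ?thesis using three_vertices_star[OF X nc] star by (auto simp: n)
  next
    case False
    then have "4 \<le> CARD('v)" using n3 n by simp
    then show ?thesis using laziness_le_star[OF X nc] by (simp add: n lazS)
  qed
  have iso: "digraph_iso X S" if u: "is_star u X" for u
  proof -
    obtain g where g: "bij_betw g (UNIV :: 'v set) (UNIV :: 'w set)"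
      using n nS finite_same_card_bij by (metis finite)
    define f where "f = Transposition.transpose (g u) w \<circ> g"
    have f: "bij_betw f UNIV UNIV"
      unfolding f_def by (rule bij_betw_trans[OF g]) simp
    have fu: "f u = w" by (simp add: f_def)
    have inj: "inj f" using f by (simp add: bij_betw_def)
    show ?thesis
    proof (rule digraph_isoI[OF assms(1) S])
      show "bij_betw f (verts X) (verts S)" using f assms(2,7) by simp
      show "x \<rightarrow>\<^bsub>X\<^esub> y \<longleftrightarrow> f x \<rightarrow>\<^bsub>S\<^esub> f y" for x y
        using u w inj by (simp add: is_star_def fu[symmetric] inj_eq)
    qed
  qed
  show ?thesis
    using main star iso digraph_iso_star[OF _ assms(2,7) w] by blast
qed

end
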